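(* Let $\mathcal C$ be a complete and cocomplete category and let $P$ be a diamond-free poset. Then $(P,\rho)$ has the connected intersections property (CIP) for any height-difference function $\rho$ on $P$. In particular, the distance $d_\rho$ on $\mathrm{Fun}(P,\mathcal C)$ satisfies a $c(\rho)$-relaxed triangle inequality: $d_\rho(M,N)\le d_\rho(M,X)+d_\rho(X,N)+c(\rho)$ for all $M,X,N\in\mathrm{Fun}(P,\mathcal C)$.
   Context: A poset is diamond-free if it has no full subposet isomorphic to the four-element diamond poset $\{a<b,\ a<c,\ b<d,\ c<d\}$ (with $b,c$ incomparable); equivalently, every interval $[a,b]$ of $P$ is totally ordered. A poset $P$ is regarded as a category (a unique morphism $a\to b$ iff $a\le b$), and $\mathrm{Fun}(P,\mathcal C)$ is the category of functors $P\to\mathcal C$ and natural transformations. All infima of empty sets are $\infty$. A height-difference function on $P$ is a function $\rho:\{(a,b)\in P\times P: a\le b\}\to[0,\infty]$ with $\rho(a,a)=0$ for all $a$ and $\rho(a,c)\ge\rho(a,b)+\rho(b,c)$ whenever $a\le b\le c$. For $a\in P$ and real $r\ge 0$ put $a^{\downarrow_r}=\{x\in P: x\le a,\ \rho(x,a)\ge r\}$ and $a^{\uparrow_r}=\{x\in P: x\ge a,\ \rho(a,x)\ge r\}$ (full subposets). CIP: $(P,\rho)$ has the connected intersections property if for all $a,q\in P$ and $s,r\ge0$ the full subposet $I_{s,r}(a,q)=a^{\downarrow_s}\cap q^{\uparrow_r}$ is empty or connected (any two elements are joined by a finite zigzag of comparabilities inside it). For $u,v\in[0,\infty]$ set $|u-v|_\infty=|u-v|$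 if $u,v<\infty$, $0$ if $u=v=\infty$, and $\infty$ otherwise. For $c\ge0$, condition (IV$_c$): for any $a\le b$ in $P$ and any $t\in[0,\infty)$ with $t\le\rho(a,b)$ there exists $z\in P$ with $a\le z\le b$, $|\rho(a,z)-t|_\infty\le c/2$ and $|\rho(z,b)-(\rho(a,b)-t)|_\infty\le c/2$. Then $c(\rho)=\inf\{c\ge0:(P,\rho)\text{ satisfies (IV}_c)\}\in[0,\infty]$. Endofunctors $\mathsf L_r=\mathsf L_r^\rho$ and $\mathsf R_r=\mathsf R_r^\rho$ of $\mathrm{Fun}(P,\mathcal C)$: $(\mathsf L_rM)(a)=\operatorname{colim} M|_{a^{\downarrow_r}}$ and $(\mathsf R_rM)(a)=\lim M|_{a^{\uparrow_r}}$, with structure morphisms for $a\le b$ (using $a^{\downarrow_r}\subseteq b^{\downarrow_r}$, $b^{\uparrow_r}\subseteq a^{\uparrow_r}$) and the action on morphisms induced by the universal properties. Write $\alpha_{a,M}(x):M(x)\to(\mathsf L_rM)(a)$ ($x\in a^{\downarrow_r}$) and $\beta_{a,M}(y):(\mathsf R_rM)(a)\to M(y)$ ($y\in a^{\uparrow_r}$) for the canonical maps. The functor $\mathsf L_r$ is left adjoint to $\mathsf R_r$; for $p:M\to\mathsf R_rN$, its adjoint $p^\sharp:\mathsf L_rM\to N$ is the unique morphism with $p^\sharp(a)\circ\alpha_{a,M}(x)=\beta_{x,N}(a)\circ p(x)$ for all $a\in P$, $x\in a^{\downarrow_r}$. Let $\eta^{\mathsf L}_{r,M}:\mathsf L_rM\to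 M$ and $\eta^{\mathsf R}_{r,M}:M\to\mathsf R_rM$ be induced by the structure maps $M(x\le a)$, $x\in a^{\downarrow_r}$, respectively $M(a\le y)$, $y\in a^{\uparrow_r}$, and set $e_{r,M}=\eta^{\mathsf R}_{r,M}\circ\eta^{\mathsf L}_{r,M}:\mathsf L_rM\to\mathsf R_rM$. $M,N\in\mathrm{Fun}(P,\mathcal C)$ are $r$-height-interleaved with respect to $\rho$ if there are $p:M\to\mathsf R_rN$ and $q:N\to\mathsf R_rM$ with $e_{r,M}=q\circ p^\sharp$ and $e_{r,N}=p\circ q^\sharp$. The height-interleaving distance is $d_\rho(M,N)=\inf\{r\ge0: M,N \text{ are } r\text{-height-interleaved w.r.t. }\rho\}\in[0,\infty]$. *)

theory Defs
  imports "HOL-Library.Extended_Nonnegative_Real"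
begin

section \<open>Categories, functors, limits and colimits\<close>

record ('o, 'm) cat =
  Ob :: "'o set"
  Arr :: "'m set"
  Dom :: "'m \<Rightarrow> 'o"
  Cod :: "'m \<Rightarrow> 'o"
  Idn :: "'o \<Rightarrow> 'm"
  Cmp :: "'m \<Rightarrow> 'm \<Rightarrow> 'm"  \<comment> \<open>\<open>Cmp C g f\<close> is \<open>g\<close> after \<open>f\<close>\<close>

definition hom :: "('o, 'm) cat \<Rightarrow> 'o \<Rightarrow> 'o \<Rightarrow> 'm set" where
  "hom C a b = {f \<in> Arr C. Dom C f = a \<and> Cod C f = b}"

locale category =
  fixes C :: "('o, 'm) cat"
  assumes Dom_in: "f \<in> Arr C \<Longrightarrow> Dom C f \<in> Ob C"
    and Cod_in: "f \<in> Arr C \<Longrightarrow> Cod C f \<in> Ob C"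
    and Idn_in: "a \<in> Ob C \<Longrightarrow> Idn C a \<in> hom C a a"
    and Cmp_in: "f \<in> hom C a b \<Longrightarrow> g \<in> hom C b c \<Longrightarrow> Cmp C g f \<in> hom C a c"
    and Cmp_Idn: "f \<in> hom C a b \<Longrightarrow> Cmp C f (Idn C a) = f"
    and Idn_Cmp: "f \<in> hom C a b \<Longrightarrow> Cmp C (Idn C b) f = f"
    and Cmp_assoc: "f \<in> hom C a b \<Longrightarrow> g \<in> hom C b c \<Longrightarrow> h \<in> hom C c d \<Longrightarrow>
                      Cmp C h (Cmp C g f) = Cmp C (Cmp C h g) f"

text \<open>Only the values of a functor on the objects and arrows of its source category are relevant.
  In particular the restriction of a functor to a subcategory is given by the same record.\<close>

record ('i, 'j, 'o, 'm) ftor =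
  OnOb :: "'i \<Rightarrow> 'o"
  OnArr :: "'j \<Rightarrow> 'm"

definition is_functor :: "('i, 'j) cat \<Rightarrow> ('o, 'm) cat \<Rightarrow> ('i, 'j, 'o, 'm) ftor \<Rightarrow> bool" where
  "is_functor I C F \<longleftrightarrow>
     (\<forall>i\<in>Ob I. OnOb F i \<in> Ob C) \<and>
     (\<forall>f\<in>Arr I. OnArr F f \<in> hom C (OnOb F (Dom I f)) (OnOb F (Cod I f))) \<and>
     (\<forall>i\<in>Ob I. OnArr F (Idn I i) = Idn C (OnOb F i)) \<and>
     (\<forall>f\<in>Arr I. \<forall>g\<in>Arr I. Cod I f = Dom I g \<longrightarrow>
        OnArr F (Cmp I g f) = Cmp C (OnArr F g) (OnArr F f))"

definition nat_trans ::
  "('i, 'j) cat \<Rightarrow> ('o, 'm) cat \<Rightarrow> ('i, 'j, 'o, 'm) ftor \<Rightarrow> ('i, 'j, 'o, 'm) ftor \<Rightarrow> ('i \<Rightarrow> 'm) \<Rightarrow> bool"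
  where
  "nat_trans I C F G \<tau> \<longleftrightarrow>
     (\<forall>i\<in>Ob I. \<tau> i \<in> hom C (OnOb F i) (OnOb G i)) \<and>
     (\<forall>f\<in>Arr I. Cmp C (\<tau> (Cod I f)) (OnArr F f) = Cmp C (OnArr G f) (\<tau> (Dom I f)))"

definition is_cone ::
  "('i, 'j) cat \<Rightarrow> ('o, 'm) cat \<Rightarrow> ('i, 'j, 'o, 'm) ftor \<Rightarrow> 'o \<Rightarrow> ('i \<Rightarrow> 'm) \<Rightarrow> bool" where
  "is_cone I C F X \<pi> \<longleftrightarrow>
     X \<in> Ob C \<and> (\<forall>i\<in>Ob I. \<pi> i \<in> hom C X (OnOb F i)) \<and>
     (\<forall>f\<in>Arr I. Cmp C (OnArr F f) (\<pi> (Dom I f)) = \<pi> (Cod I f))"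

definition is_cocone ::
  "('i, 'j) cat \<Rightarrow> ('o, 'm) cat \<Rightarrow> ('i, 'j, 'o, 'm) ftor \<Rightarrow> 'o \<Rightarrow> ('i \<Rightarrow> 'm) \<Rightarrow> bool" where
  "is_cocone I C F X \<iota> \<longleftrightarrow>
     X \<in> Ob C \<and> (\<forall>i\<in>Ob I. \<iota> i \<in> hom C (OnOb F i) X) \<and>
     (\<forall>f\<in>Arr I. Cmp C (\<iota> (Cod I f)) (OnArr F f) = \<iota> (Dom I f))"

definition is_limit ::
  "('i, 'j) cat \<Rightarrow> ('o, 'm) cat \<Rightarrow> ('i, 'j, 'o, 'm) ftor \<Rightarrow> 'o \<Rightarrow> ('i \<Rightarrow> 'm) \<Rightarrow> bool" where
  "is_limit I C F X \<pi> \<longleftrightarrow> is_cone I C F X \<pi> \<and>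
     (\<forall>Y \<kappa>. is_cone I C F Y \<kappa> \<longrightarrow>
        (\<exists>!u. u \<in> hom C Y X \<and> (\<forall>i\<in>Ob I. Cmp C (\<pi> i) u = \<kappa> i)))"

definition is_colimit ::
  "('i, 'j) cat \<Rightarrow> ('o, 'm) cat \<Rightarrow> ('i, 'j, 'o, 'm) ftor \<Rightarrow> 'o \<Rightarrow> ('i \<Rightarrow> 'm) \<Rightarrow> bool" where
  "is_colimit I C F X \<iota> \<longleftrightarrow> is_cocone I C F X \<iota> \<and>
     (\<forall>Y \<kappa>. is_cocone I C F Y \<kappa> \<longrightarrow>
        (\<exists>!u. u \<in> hom C X Y \<and> (\<forall>i\<in>Ob I. Cmp C u (\<iota> i) = \<kappa> i)))"

text \<open>Smallness is relative to an arbitrary type \<open>'u\<close> playing the role of the universe: a set is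
  small if it embeds into \<open>'u\<close>, and the shapes of the diagrams required to have a (co)limit are the
  categories whose objects and arrows are elements of \<open>'u\<close>.\<close>

definition small_set :: "'u itself \<Rightarrow> 'a set \<Rightarrow> bool" where
  "small_set U S \<longleftrightarrow> (\<exists>f :: 'a \<Rightarrow> 'u. inj_on f S)"

definition complete_category :: "'u itself \<Rightarrow> ('o, 'm) cat \<Rightarrow> bool" where
  "complete_category U C \<longleftrightarrow>
     (\<forall>(I :: ('u, 'u) cat) F. category I \<longrightarrow> is_functor I C F \<longrightarrow> (\<exists>X \<pi>. is_limit I C F X \<pi>))"

definition cocomplete_category :: "'u itself \<Rightarrow> ('o, 'm) cat \<Rightarrow> bool" where
  "cocomplete_category U C \<longleftrightarrow>
     (\<forall>(I :: ('u, 'u) cat) F. category I \<longrightarrow> is_functor I C F \<longrightarrow> (\<exists>X \<iota>. is_colimit I C F X \<iota>))"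

text \<open>A choice of (co)limit for every diagram, and the morphisms induced by the universal
  properties. These are meaningful only if the (co)limit exists and \<open>\<kappa>\<close> is a (co)cone.\<close>

definition limit :: "('i, 'j) cat \<Rightarrow> ('o, 'm) cat \<Rightarrow> ('i, 'j, 'o, 'm) ftor \<Rightarrow> 'o \<times> ('i \<Rightarrow> 'm)" where
  "limit I C F = (SOME (X, \<pi>). is_limit I C F X \<pi>)"

definition colimit :: "('i, 'j) cat \<Rightarrow> ('o, 'm) cat \<Rightarrow> ('i, 'j, 'o, 'm) ftor \<Rightarrow> 'o \<times> ('i \<Rightarrow> 'm)" where
  "colimit I C F = (SOME (X, \<iota>). is_colimit I C F X \<iota>)"

definition to_limit ::
  "('i, 'j) cat \<Rightarrow> ('o, 'm) cat \<Rightarrow> ('i, 'j, 'o, 'm) ftor \<Rightarrow> 'o \<Rightarrow> ('i \<Rightarrow> 'm) \<Rightarrow> 'm" where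
  "to_limit I C F Y \<kappa> =
     (THE u. u \<in> hom C Y (fst (limit I C F)) \<and> (\<forall>i\<in>Ob I. Cmp C (snd (limit I C F) i) u = \<kappa> i))"

definition from_colimit ::
  "('i, 'j) cat \<Rightarrow> ('o, 'm) cat \<Rightarrow> ('i, 'j, 'o, 'm) ftor \<Rightarrow> 'o \<Rightarrow> ('i \<Rightarrow> 'm) \<Rightarrow> 'm" where
  "from_colimit I C F Y \<kappa> =
     (THE u. u \<in> hom C (fst (colimit I C F)) Y \<and> (\<forall>i\<in>Ob I. Cmp C u (snd (colimit I C F) i) = \<kappa> i))"

section \<open>Posets\<close>

text \<open>A poset is a (possibly empty) subset \<open>P\<close> of a type of class \<open>order\<close>. The arrow \<open>a \<rightarrow> b\<close>
  witnessing \<open>a \<le> b\<close> is the pair \<open>(a, b)\<close>.\<close>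

definition poset_cat :: "'p::order set \<Rightarrow> ('p, 'p \<times> 'p) cat" where
  "poset_cat S = \<lparr>Ob = S, Arr = {(a, b). a \<in> S \<and> b \<in> S \<and> a \<le> b},
     Dom = fst, Cod = snd, Idn = (\<lambda>a. (a, a)), Cmp = (\<lambda>g f. (fst f, snd g))\<rparr>"

lemma category_poset_cat: "category (poset_cat S)"
  by unfold_locales (auto simp: poset_cat_def hom_def)

definition diamond_free :: "'p::order set \<Rightarrow> bool" where
  "diamond_free P \<longleftrightarrow>
     \<not> (\<exists>a\<in>P. \<exists>b\<in>P. \<exists>c\<in>P. \<exists>d\<in>P. a < b \<and> a < c \<and> b < d \<and> c < d \<and> \<not> b \<le> c \<and> \<not> c \<le> b)"

definition zigzag_connected :: "'p::order set \<Rightarrow> bool" where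
  "zigzag_connected S \<longleftrightarrow>
     (\<forall>x\<in>S. \<forall>y\<in>S. (x, y) \<in> {(u, v). u \<in> S \<and> v \<in> S \<and> (u \<le> v \<or> v \<le> u)}\<^sup>*)"

section \<open>Height-difference functions\<close>

text \<open>Only the values \<open>\<rho> a b\<close> with \<open>a \<le> b\<close> in \<open>P\<close> are relevant.\<close>

definition height_difference :: "'p::order set \<Rightarrow> ('p \<Rightarrow> 'p \<Rightarrow> ennreal) \<Rightarrow> bool" where
  "height_difference P \<rho> \<longleftrightarrow>
     (\<forall>a\<in>P. \<rho> a a = 0) \<and>
     (\<forall>a\<in>P. \<forall>b\<in>P. \<forall>c\<in>P. a \<le> b \<longrightarrow> b \<le> c \<longrightarrow> \<rho> a c \<ge> \<rho> a b + \<rho> b c)"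

definition down_set :: "'p::order set \<Rightarrow> ('p \<Rightarrow> 'p \<Rightarrow> ennreal) \<Rightarrow> real \<Rightarrow> 'p \<Rightarrow> 'p set" where
  "down_set P \<rho> r a = {x \<in> P. x \<le> a \<and> \<rho> x a \<ge> ennreal r}"

definition up_set :: "'p::order set \<Rightarrow> ('p \<Rightarrow> 'p \<Rightarrow> ennreal) \<Rightarrow> real \<Rightarrow> 'p \<Rightarrow> 'p set" where
  "up_set P \<rho> r a = {x \<in> P. a \<le> x \<and> \<rho> a x \<ge> ennreal r}"

definition CIP :: "'p::order set \<Rightarrow> ('p \<Rightarrow> 'p \<Rightarrow> ennreal) \<Rightarrow> bool" where
  "CIP P \<rho> \<longleftrightarrow>
     (\<forall>a\<in>P. \<forall>q\<in>P. \<forall>s\<ge>0. \<forall>r\<ge>0.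
        down_set P \<rho> s a \<inter> up_set P \<rho> r q = {} \<or>
        zigzag_connected (down_set P \<rho> s a \<inter> up_set P \<rho> r q))"

definition dist_inf :: "ennreal \<Rightarrow> ennreal \<Rightarrow> ennreal" where
  "dist_inf u v =
     (if u < \<infinity> \<and> v < \<infinity> then ennreal \<bar>enn2real u - enn2real v\<bar>
      else if u = \<infinity> \<and> v = \<infinity> then 0 else \<infinity>)"

definition IV :: "'p::order set \<Rightarrow> ('p \<Rightarrow> 'p \<Rightarrow> ennreal) \<Rightarrow> real \<Rightarrow> bool" where
  "IV P \<rho> c \<longleftrightarrow>
     (\<forall>a\<in>P. \<forall>b\<in>P. \<forall>t\<ge>0. a \<le> b \<longrightarrow> ennreal t \<le> \<rho> a b \<longrightarrow>
        (\<exists>z\<in>P. a \<le> z \<and> z \<le> b \<and>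
           dist_inf (\<rho> a z) (ennreal t) \<le> ennreal (c / 2) \<and>
           dist_inf (\<rho> z b) (\<rho> a b - ennreal t) \<le> ennreal (c / 2)))"

definition iv_const :: "'p::order set \<Rightarrow> ('p \<Rightarrow> 'p \<Rightarrow> ennreal) \<Rightarrow> ennreal" where
  "iv_const P \<rho> = Inf {ennreal c | c. 0 \<le> c \<and> IV P \<rho> c}"

section \<open>Height interleavings\<close>

type_synonym ('p, 'o, 'm) pfun = "('p, 'p \<times> 'p, 'o, 'm) ftor"

definition L_alpha ::
  "'p::order set \<Rightarrow> ('p \<Rightarrow> 'p \<Rightarrow> ennreal) \<Rightarrow> ('o, 'm) cat \<Rightarrow> real \<Rightarrow> ('p, 'o, 'm) pfun \<Rightarrow> 'p \<Rightarrow> 'p \<Rightarrow> 'm"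
  where
  "L_alpha P \<rho> C r M a = snd (colimit (poset_cat (down_set P \<rho> r a)) C M)"

definition R_beta ::
  "'p::order set \<Rightarrow> ('p \<Rightarrow> 'p \<Rightarrow> ennreal) \<Rightarrow> ('o, 'm) cat \<Rightarrow> real \<Rightarrow> ('p, 'o, 'm) pfun \<Rightarrow> 'p \<Rightarrow> 'p \<Rightarrow> 'm"
  where
  "R_beta P \<rho> C r M a = snd (limit (poset_cat (up_set P \<rho> r a)) C M)"

definition L_obj ::
  "'p::order set \<Rightarrow> ('p \<Rightarrow> 'p \<Rightarrow> ennreal) \<Rightarrow> ('o, 'm) cat \<Rightarrow> real \<Rightarrow> ('p, 'o, 'm) pfun \<Rightarrow> 'p \<Rightarrow> 'o" where
  "L_obj P \<rho> C r M a = fst (colimit (poset_cat (down_set P \<rho> r a)) C M)"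

definition R_obj ::
  "'p::order set \<Rightarrow> ('p \<Rightarrow> 'p \<Rightarrow> ennreal) \<Rightarrow> ('o, 'm) cat \<Rightarrow> real \<Rightarrow> ('p, 'o, 'm) pfun \<Rightarrow> 'p \<Rightarrow> 'o" where
  "R_obj P \<rho> C r M a = fst (limit (poset_cat (up_set P \<rho> r a)) C M)"

definition L_functor ::
  "'p::order set \<Rightarrow> ('p \<Rightarrow> 'p \<Rightarrow> ennreal) \<Rightarrow> ('o, 'm) cat \<Rightarrow> real \<Rightarrow> ('p, 'o, 'm) pfun \<Rightarrow> ('p, 'o, 'm) pfun"
  where
  "L_functor P \<rho> C r M =
     \<lparr>OnOb = L_obj P \<rho> C r M,
      OnArr = (\<lambda>(a, b). from_colimit (poset_cat (down_set P \<rho> r a)) C M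
                           (L_obj P \<rho> C r M b) (L_alpha P \<rho> C r M b))\<rparr>"

definition R_functor ::
  "'p::order set \<Rightarrow> ('p \<Rightarrow> 'p \<Rightarrow> ennreal) \<Rightarrow> ('o, 'm) cat \<Rightarrow> real \<Rightarrow> ('p, 'o, 'm) pfun \<Rightarrow> ('p, 'o, 'm) pfun"
  where
  "R_functor P \<rho> C r M =
     \<lparr>OnOb = R_obj P \<rho> C r M,
      OnArr = (\<lambda>(a, b). to_limit (poset_cat (up_set P \<rho> r b)) C M
                           (R_obj P \<rho> C r M a) (R_beta P \<rho> C r M a))\<rparr>"

definition L_eta ::
  "'p::order set \<Rightarrow> ('p \<Rightarrow> 'p \<Rightarrow> ennreal) \<Rightarrow> ('o, 'm) cat \<Rightarrow> real \<Rightarrow> ('p, 'o, 'm) pfun \<Rightarrow> 'p \<Rightarrow> 'm" where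
  "L_eta P \<rho> C r M a =
     from_colimit (poset_cat (down_set P \<rho> r a)) C M (OnOb M a) (\<lambda>x. OnArr M (x, a))"

definition R_eta ::
  "'p::order set \<Rightarrow> ('p \<Rightarrow> 'p \<Rightarrow> ennreal) \<Rightarrow> ('o, 'm) cat \<Rightarrow> real \<Rightarrow> ('p, 'o, 'm) pfun \<Rightarrow> 'p \<Rightarrow> 'm" where
  "R_eta P \<rho> C r M a =
     to_limit (poset_cat (up_set P \<rho> r a)) C M (OnOb M a) (\<lambda>y. OnArr M (a, y))"

definition e_map ::
  "'p::order set \<Rightarrow> ('p \<Rightarrow> 'p \<Rightarrow> ennreal) \<Rightarrow> ('o, 'm) cat \<Rightarrow> real \<Rightarrow> ('p, 'o, 'm) pfun \<Rightarrow> 'p \<Rightarrow> 'm" where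
  "e_map P \<rho> C r M a = Cmp C (R_eta P \<rho> C r M a) (L_eta P \<rho> C r M a)"

text \<open>The adjoint \<open>p\<^sup>\<sharp> : L\<^sub>r M \<rightarrow> N\<close> of \<open>p : M \<rightarrow> R\<^sub>r N\<close>: its component at \<open>a\<close> is the unique
  morphism satisfying \<open>p\<^sup>\<sharp>(a) \<circ> \<alpha>\<^sub>a(x) = \<beta>\<^sub>x(a) \<circ> p(x)\<close> for all \<open>x\<close> in the down-set of \<open>a\<close>.\<close>

definition sharp ::
  "'p::order set \<Rightarrow> ('p \<Rightarrow> 'p \<Rightarrow> ennreal) \<Rightarrow> ('o, 'm) cat \<Rightarrow> real \<Rightarrow>
     ('p, 'o, 'm) pfun \<Rightarrow> ('p, 'o, 'm) pfun \<Rightarrow> ('p \<Rightarrow> 'm) \<Rightarrow> 'p \<Rightarrow> 'm" where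
  "sharp P \<rho> C r M N p a =
     from_colimit (poset_cat (down_set P \<rho> r a)) C M (OnOb N a)
       (\<lambda>x. Cmp C (R_beta P \<rho> C r N x a) (p x))"

definition height_interleaved ::
  "'p::order set \<Rightarrow> ('p \<Rightarrow> 'p \<Rightarrow> ennreal) \<Rightarrow> ('o, 'm) cat \<Rightarrow> real \<Rightarrow>
     ('p, 'o, 'm) pfun \<Rightarrow> ('p, 'o, 'm) pfun \<Rightarrow> bool" where
  "height_interleaved P \<rho> C r M N \<longleftrightarrow>
     (\<exists>p q. nat_trans (poset_cat P) C M (R_functor P \<rho> C r N) p \<and>
            nat_trans (poset_cat P) C N (R_functor P \<rho> C r M) q \<and>
            (\<forall>a\<in>P. e_map P \<rho> C r M a = Cmp C (q a) (sharp P \<rho> C r M N p a)) \<and>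
            (\<forall>a\<in>P. e_map P \<rho> C r N a = Cmp C (p a) (sharp P \<rho> C r N M q a)))"

definition height_dist ::
  "'p::order set \<Rightarrow> ('p \<Rightarrow> 'p \<Rightarrow> ennreal) \<Rightarrow> ('o, 'm) cat \<Rightarrow>
     ('p, 'o, 'm) pfun \<Rightarrow> ('p, 'o, 'm) pfun \<Rightarrow> ennreal" where
  "height_dist P \<rho> C M N = Inf {ennreal r | r. 0 \<le> r \<and> height_interleaved P \<rho> C r M N}"

end

theory Submission
  imports Defs
begin

text \<open>By the universal properties, a morphism \<open>p : M \<rightarrow> R\<^sub>r N\<close> is a family of morphisms
  \<open>\<phi> x y : M x \<rightarrow> N y\<close>, indexed by the pairs \<open>x \<le> y\<close> with \<open>\<rho> x y \<ge> r\<close> and natural in both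
  variables, and an \<open>r\<close>-height-interleaving is a pair of such families with \<open>\<psi> a y \<circ> \<phi> x a = M(x \<le> y)\<close>
  and \<open>\<phi> a y \<circ> \<psi> x a = N(x \<le> y)\<close>.
  To compose an \<open>r\<close>-interleaving through \<open>X\<close> with an \<open>s\<close>-interleaving, factor \<open>M x \<rightarrow> N y\<close>
  through \<open>X z\<close> for some \<open>z\<close> with \<open>\<rho> x z \<ge> r\<close> and \<open>\<rho> z y \<ge> s\<close>. Such a \<open>z\<close> exists by
  (IV\<open>\<^sub>c\<close>) as soon as \<open>\<rho> x y \<ge> r + s + c\<close>. The composite agrees for comparable choices of
  \<open>z\<close>, hence on connected intersections it does not depend on \<open>z\<close>. In a diamond-free poset any
  two choices are comparable, since they lie in the chain \<open>[x, y]\<close>.\<close>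

section \<open>Limits and colimits of small shape\<close>

lemma homD:
  assumes "f \<in> hom C a b"
  shows "f \<in> Arr C" "Dom C f = a" "Cod C f = b"
  using assms by (auto simp: hom_def)

context category
begin

lemma Arr_hom: "f \<in> Arr C \<Longrightarrow> f \<in> hom C (Dom C f) (Cod C f)"
  by (simp add: hom_def)

lemma Idn_simps:
  assumes "a \<in> Ob C"
  shows "Idn C a \<in> Arr C" "Dom C (Idn C a) = a" "Cod C (Idn C a) = a"
  using homD[OF Idn_in[OF assms]] by auto

lemma Cmp_simps:
  assumes "f \<in> Arr C" "g \<in> Arr C" "Dom C g = Cod C f"
  shows "Cmp C g f \<in> Arr C" "Dom C (Cmp C g f) = Dom C f" "Cod C (Cmp C g f) = Cod C g"
  using homD[OF Cmp_in[of f _ _ g "Cod C g"]] assms by (auto simp: hom_def)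

end

section \<open>Transport of a small category and its diagrams into the universe type\<close>

definition image_cat :: "('i \<Rightarrow> 'u) \<Rightarrow> ('j \<Rightarrow> 'v) \<Rightarrow> ('i, 'j) cat \<Rightarrow> ('u, 'v) cat" where
  "image_cat g f J = \<lparr>Ob = g ` Ob J, Arr = f ` Arr J,
     Dom = (\<lambda>k. g (Dom J (inv_into (Arr J) f k))),
     Cod = (\<lambda>k. g (Cod J (inv_into (Arr J) f k))),
     Idn = (\<lambda>i. f (Idn J (inv_into (Ob J) g i))),
     Cmp = (\<lambda>k l. f (Cmp J (inv_into (Arr J) f k) (inv_into (Arr J) f l)))\<rparr>"

definition image_ftor ::
  "('i \<Rightarrow> 'u) \<Rightarrow> ('j \<Rightarrow> 'v) \<Rightarrow> ('i, 'j) cat \<Rightarrow> ('i, 'j, 'o, 'm) ftor \<Rightarrow> ('u, 'v, 'o, 'm) ftor" where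
  "image_ftor g f J F = \<lparr>OnOb = (\<lambda>i. OnOb F (inv_into (Ob J) g i)),
     OnArr = (\<lambda>k. OnArr F (inv_into (Arr J) f k))\<rparr>"

text \<open>\<open>complete_category\<close> and \<open>cocomplete_category\<close> speak only of
  shapes whose objects and arrows are elements of \<open>'u\<close>, whereas poset categories live
  on other types. Injectivity on \<open>Ob J\<close> and \<open>Arr J\<close> makes
  \<open>image_cat g f J\<close> an isomorphic copy of \<open>J\<close>, from which
  \<open>inv_into\<close> recovers the original.\<close>

locale embedded_category = J: category J
  for J :: "('i, 'j) cat" +
  fixes g :: "'i \<Rightarrow> 'u" and f :: "'j \<Rightarrow> 'v"
  assumes inj_g: "inj_on g (Ob J)" and inj_f: "inj_on f (Arr J)"
begin

lemma image_cat_simps [simp]: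
  "Ob (image_cat g f J) = g ` Ob J"
  "Arr (image_cat g f J) = f ` Arr J"
  "j \<in> Arr J \<Longrightarrow> Dom (image_cat g f J) (f j) = g (Dom J j)"
  "j \<in> Arr J \<Longrightarrow> Cod (image_cat g f J) (f j) = g (Cod J j)"
  "i \<in> Ob J \<Longrightarrow> Idn (image_cat g f J) (g i) = f (Idn J i)"
  "j \<in> Arr J \<Longrightarrow> k \<in> Arr J \<Longrightarrow> Cmp (image_cat g f J) (f k) (f j) = f (Cmp J k j)"
  using inj_g inj_f by (simp_all add: image_cat_def)

lemma image_ftor_simps [simp]:
  "i \<in> Ob J \<Longrightarrow> OnOb (image_ftor g f J F) (g i) = OnOb F i"
  "j \<in> Arr J \<Longrightarrow> OnArr (image_ftor g f J F) (f j) = OnArr F j"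
  using inj_g inj_f by (simp_all add: image_ftor_def)

lemma hom_image_catE:
  assumes "k \<in> hom (image_cat g f J) a b"
  obtains j where "j \<in> Arr J" "k = f j" "a = g (Dom J j)" "b = g (Cod J j)"
  using assms unfolding hom_def by auto

lemma hom_image_catI: "j \<in> hom J i i' \<Longrightarrow> f j \<in> hom (image_cat g f J) (g i) (g i')"
  by (auto simp: hom_def)

lemma g_eq_iff: "i \<in> Ob J \<Longrightarrow> i' \<in> Ob J \<Longrightarrow> g i = g i' \<longleftrightarrow> i = i'"
  using inj_g by (auto dest: inj_onD)

lemma category_image_cat: "category (image_cat g f J)"
proof
  fix k l m a b c d
  assume "k \<in> hom (image_cat g f J) a b"
  then obtain k' where k: "k' \<in> Arr J" "k = f k'" "a = g (Dom J k')" "b = g (Cod J k')"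
    by (rule hom_image_catE)
  note Dom_k = J.Dom_in[OF k(1)] and Cod_k = J.Cod_in[OF k(1)]
  show "Cmp (image_cat g f J) k (Idn (image_cat g f J) a) = k"
    using k Dom_k by (simp add: J.Idn_simps J.Cmp_Idn[OF J.Arr_hom])
  show "Cmp (image_cat g f J) (Idn (image_cat g f J) b) k = k"
    using k Cod_k by (simp add: J.Idn_simps J.Idn_Cmp[OF J.Arr_hom])
  assume "l \<in> hom (image_cat g f J) b c"
  then obtain l' where l: "l' \<in> Arr J" "l = f l'" "b = g (Dom J l')" "c = g (Cod J l')"
    by (rule hom_image_catE)
  \<comment> \<open>Composability in the copy only says that the images under \<open>g\<close>
    agree; injectivity of \<open>g\<close> turns this into composability in
    \<open>J\<close>.\<close>
  then have kl: "Dom J l' = Cod J k'"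
    using k Cod_k J.Dom_in by (simp add: g_eq_iff)
  show "Cmp (image_cat g f J) l k \<in> hom (image_cat g f J) a c"
    using k l kl by (simp add: hom_def J.Cmp_simps)
  assume "m \<in> hom (image_cat g f J) c d"
  then obtain m' where m: "m' \<in> Arr J" "m = f m'" "c = g (Dom J m')" "d = g (Cod J m')"
    by (rule hom_image_catE)
  then have lm: "Dom J m' = Cod J l'"
    using l J.Cod_in J.Dom_in by (simp add: g_eq_iff)
  have "Cmp J m' (Cmp J l' k') = Cmp J (Cmp J m' l') k'"
    using k(1) l(1) m(1) kl lm by (intro J.Cmp_assoc) (auto simp: hom_def)
  then show "Cmp (image_cat g f J) m (Cmp (image_cat g f J) l k) =
      Cmp (image_cat g f J) (Cmp (image_cat g f J) m l) k"
    using k l m kl lm by (simp add: J.Cmp_simps)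
qed (auto simp: J.Dom_in J.Cod_in intro!: hom_image_catI J.Idn_in)

lemma is_functor_image_ftor:
  assumes F: "is_functor J C F"
  shows "is_functor (image_cat g f J) C (image_ftor g f J F)"
proof -
  show ?thesis
    using F unfolding is_functor_def
    by (simp add: J.Dom_in J.Cod_in g_eq_iff J.Idn_simps J.Cmp_simps)
qed

lemma is_cone_image:
  "is_cone (image_cat g f J) C (image_ftor g f J F) X \<kappa> \<longleftrightarrow> is_cone J C F X (\<lambda>i. \<kappa> (g i))"
  by (auto simp: is_cone_def J.Dom_in J.Cod_in)

lemma is_cocone_image:
  "is_cocone (image_cat g f J) C (image_ftor g f J F) X \<kappa> \<longleftrightarrow> is_cocone J C F X (\<lambda>i. \<kappa> (g i))"
  by (auto simp: is_cocone_def J.Dom_in J.Cod_in)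

text \<open>Renaming the indices along \<open>g\<close> matches cones over the copied diagram with
  cones over \<open>F\<close>. The apex and the mediating arrows stay the same, so the universal
  property carries over.\<close>

lemma is_limit_of_image:
  assumes "is_limit (image_cat g f J) C (image_ftor g f J F) X \<pi>"
  shows "is_limit J C F X (\<lambda>i. \<pi> (g i))"
  unfolding is_limit_def
proof (intro conjI allI impI)
  show "is_cone J C F X (\<lambda>i. \<pi> (g i))"
    using assms by (simp add: is_limit_def is_cone_image)
next
  fix Y \<kappa> assume "is_cone J C F Y \<kappa>"
  then have "is_cone (image_cat g f J) C (image_ftor g f J F) Y (\<lambda>k. \<kappa> (inv_into (Ob J) g k))"
    by (simp add: is_cone_def inj_g J.Dom_in J.Cod_in)
  then have "\<exists>!u. u \<in> hom C Y X \<and>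
      (\<forall>k\<in>Ob (image_cat g f J). Cmp C (\<pi> k) u = \<kappa> (inv_into (Ob J) g k))"
    using assms by (simp only: is_limit_def)
  then show "\<exists>!u. u \<in> hom C Y X \<and> (\<forall>i\<in>Ob J. Cmp C (\<pi> (g i)) u = \<kappa> i)"
    by (simp add: inj_g)
qed

lemma is_colimit_of_image:
  assumes "is_colimit (image_cat g f J) C (image_ftor g f J F) X \<pi>"
  shows "is_colimit J C F X (\<lambda>i. \<pi> (g i))"
  unfolding is_colimit_def
proof (intro conjI allI impI)
  show "is_cocone J C F X (\<lambda>i. \<pi> (g i))"
    using assms by (simp add: is_colimit_def is_cocone_image)
next
  fix Y \<kappa> assume "is_cocone J C F Y \<kappa>"
  then have "is_cocone (image_cat g f J) C (image_ftor g f J F) Y (\<lambda>k. \<kappa> (inv_into (Ob J) g k))"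
    by (simp add: is_cocone_def inj_g J.Dom_in J.Cod_in)
  then have "\<exists>!u. u \<in> hom C X Y \<and>
      (\<forall>k\<in>Ob (image_cat g f J). Cmp C u (\<pi> k) = \<kappa> (inv_into (Ob J) g k))"
    using assms by (simp only: is_colimit_def)
  then show "\<exists>!u. u \<in> hom C X Y \<and> (\<forall>i\<in>Ob J. Cmp C u (\<pi> (g i)) = \<kappa> i)"
    by (simp add: inj_g)
qed

end

text \<open>Smallness of the set of arrows is enough: an object is the domain of its identity, so
  sending it to the code of its identity arrow is injective.\<close>

lemma small_category_embedding:
  assumes "category J" and "small_set TYPE('u) (Arr J)"
  obtains g f :: "_ \<Rightarrow> 'u" where "embedded_category J g f"
proof -
  interpret category J by fact
  obtain f :: "_ \<Rightarrow> 'u" where f: "inj_on f (Arr J)"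
    using assms(2) by (auto simp: small_set_def)
  have "inj_on (\<lambda>i. f (Idn J i)) (Ob J)"
  proof (rule inj_onI)
    fix i j assume ij: "i \<in> Ob J" "j \<in> Ob J" "f (Idn J i) = f (Idn J j)"
    then have "Idn J i = Idn J j"
      by (intro inj_onD[OF f]) (simp_all add: Idn_simps)
    then have "Dom J (Idn J i) = Dom J (Idn J j)"
      by simp
    then show "i = j"
      using ij by (simp add: Idn_simps)
  qed
  then have "embedded_category J (\<lambda>i. f (Idn J i)) f"
    using f by unfold_locales
  then show thesis by (rule that)
qed

lemma complete_category_has_limit:
  assumes "complete_category TYPE('u) C" "category J" "small_set TYPE('u) (Arr J)"
    "is_functor J C F"
  shows "\<exists>X \<pi>. is_limit J C F X \<pi>"
proof -
  obtain g f :: "_ \<Rightarrow> 'u" where "embedded_category J g f"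
    using small_category_embedding[OF assms(2,3)] .
  then interpret embedded_category J g f .
  obtain X \<pi> where "is_limit (image_cat g f J) C (image_ftor g f J F) X \<pi>"
    using assms(1) category_image_cat is_functor_image_ftor[OF assms(4)]
    unfolding complete_category_def by blast
  from is_limit_of_image[OF this] show ?thesis by (intro exI)
qed

lemma cocomplete_category_has_colimit:
  assumes "cocomplete_category TYPE('u) C" "category J" "small_set TYPE('u) (Arr J)"
    "is_functor J C F"
  shows "\<exists>X \<iota>. is_colimit J C F X \<iota>"
proof -
  obtain g f :: "_ \<Rightarrow> 'u" where "embedded_category J g f"
    using small_category_embedding[OF assms(2,3)] .
  then interpret embedded_category J g f .
  obtain X \<iota> where "is_colimit (image_cat g f J) C (image_ftor g f J F) X \<iota>"
    using assms(1) category_image_cat is_functor_image_ftor[OF assms(4)]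
    unfolding cocomplete_category_def by blast
  from is_colimit_of_image[OF this] show ?thesis by (intro exI)
qed

section \<open>Chosen limits and colimits, and uniqueness of induced arrows\<close>

lemma is_limit_limit:
  assumes "\<exists>X \<pi>. is_limit I C F X \<pi>"
  shows "is_limit I C F (fst (limit I C F)) (snd (limit I C F))"
proof -
  obtain X \<pi> where "is_limit I C F X \<pi>" using assms by blast
  then have "case limit I C F of (X, \<pi>) \<Rightarrow> is_limit I C F X \<pi>"
    unfolding limit_def
    by (intro someI[of "\<lambda>(X, \<pi>). is_limit I C F X \<pi>" "(X, \<pi>)"]) simp
  then show ?thesis by (simp add: case_prod_unfold)
qed

lemma is_colimit_colimit:
  assumes "\<exists>X \<iota>. is_colimit I C F X \<iota>"
  shows "is_colimit I C F (fst (colimit I C F)) (snd (colimit I C F))"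
proof -
  obtain X \<iota> where "is_colimit I C F X \<iota>" using assms by blast
  then have "case colimit I C F of (X, \<iota>) \<Rightarrow> is_colimit I C F X \<iota>"
    unfolding colimit_def
    by (intro someI[of "\<lambda>(X, \<iota>). is_colimit I C F X \<iota>" "(X, \<iota>)"]) simp
  then show ?thesis by (simp add: case_prod_unfold)
qed

lemma to_limit:
  assumes "\<exists>X \<pi>. is_limit I C F X \<pi>" "is_cone I C F Y \<kappa>"
  shows "to_limit I C F Y \<kappa> \<in> hom C Y (fst (limit I C F))"
    and "i \<in> Ob I \<Longrightarrow> Cmp C (snd (limit I C F) i) (to_limit I C F Y \<kappa>) = \<kappa> i"
proof -
  have "\<exists>!u. u \<in> hom C Y (fst (limit I C F)) \<and> (\<forall>i\<in>Ob I. Cmp C (snd (limit I C F) i) u = \<kappa> i)"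
    using is_limit_limit[OF assms(1)] assms(2) by (simp add: is_limit_def)
  from theI'[OF this]
  show "to_limit I C F Y \<kappa> \<in> hom C Y (fst (limit I C F))"
    and "i \<in> Ob I \<Longrightarrow> Cmp C (snd (limit I C F) i) (to_limit I C F Y \<kappa>) = \<kappa> i"
    by (auto simp: to_limit_def)
qed

lemma from_colimit:
  assumes "\<exists>X \<iota>. is_colimit I C F X \<iota>" "is_cocone I C F Y \<kappa>"
  shows "from_colimit I C F Y \<kappa> \<in> hom C (fst (colimit I C F)) Y"
    and "i \<in> Ob I \<Longrightarrow> Cmp C (from_colimit I C F Y \<kappa>) (snd (colimit I C F) i) = \<kappa> i"
proof -
  have "\<exists>!u. u \<in> hom C (fst (colimit I C F)) Y \<and>
      (\<forall>i\<in>Ob I. Cmp C u (snd (colimit I C F) i) = \<kappa> i)"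
    using is_colimit_colimit[OF assms(1)] assms(2) by (simp add: is_colimit_def)
  from theI'[OF this]
  show "from_colimit I C F Y \<kappa> \<in> hom C (fst (colimit I C F)) Y"
    and "i \<in> Ob I \<Longrightarrow> Cmp C (from_colimit I C F Y \<kappa>) (snd (colimit I C F) i) = \<kappa> i"
    by (auto simp: from_colimit_def)
qed

context category
begin

text \<open>The projections of a limit are jointly monic: composing them with \<open>u\<close> gives
  a cone, and both \<open>u\<close> and \<open>v\<close> mediate it.\<close>

lemma limit_arrow_eqI:
  assumes "is_limit I C F X \<pi>" "u \<in> hom C Y X" "v \<in> hom C Y X" "category I"
    and eq: "\<And>i. i \<in> Ob I \<Longrightarrow> Cmp C (\<pi> i) u = Cmp C (\<pi> i) v"
    and F: "is_functor I C F"
  shows "u = v"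
proof -
  have \<pi>: "\<pi> i \<in> hom C X (OnOb F i)" if "i \<in> Ob I" for i
    using assms(1) that by (simp add: is_limit_def is_cone_def)
  have "is_cone I C F Y (\<lambda>i. Cmp C (\<pi> i) u)"
    unfolding is_cone_def
  proof (intro conjI ballI)
    show "Y \<in> Ob C" using assms(2) Dom_in by (auto simp: hom_def)
  next
    fix i assume "i \<in> Ob I"
    then show "Cmp C (\<pi> i) u \<in> hom C Y (OnOb F i)"
      using Cmp_in assms(2) \<pi> by blast
  next
    fix k assume k: "k \<in> Arr I"
    then have Ob: "Dom I k \<in> Ob I" "Cod I k \<in> Ob I"
      using assms(4) by (auto intro: category.Dom_in category.Cod_in)
    have "OnArr F k \<in> hom C (OnOb F (Dom I k)) (OnOb F (Cod I k))"
      using F k by (simp add: is_functor_def)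
    then have "Cmp C (OnArr F k) (Cmp C (\<pi> (Dom I k)) u) =
        Cmp C (Cmp C (OnArr F k) (\<pi> (Dom I k))) u"
      using Cmp_assoc assms(2) \<pi>[OF Ob(1)] by blast
    then show "Cmp C (OnArr F k) (Cmp C (\<pi> (Dom I k)) u) = Cmp C (\<pi> (Cod I k)) u"
      using assms(1) k by (simp add: is_limit_def is_cone_def)
  qed
  then have "\<exists>!w. w \<in> hom C Y X \<and> (\<forall>i\<in>Ob I. Cmp C (\<pi> i) w = Cmp C (\<pi> i) u)"
    using assms(1) by (simp add: is_limit_def)
  then obtain w where w: "w' = w"
    if "w' \<in> hom C Y X" "\<And>i. i \<in> Ob I \<Longrightarrow> Cmp C (\<pi> i) w' = Cmp C (\<pi> i) u" for w'
    by (elim ex1E) blast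
  show ?thesis using w[OF assms(2)] w[OF assms(3)] eq by simp
qed

lemma colimit_arrow_eqI:
  assumes "is_colimit I C F X \<iota>" "u \<in> hom C X Y" "v \<in> hom C X Y" "category I"
    and eq: "\<And>i. i \<in> Ob I \<Longrightarrow> Cmp C u (\<iota> i) = Cmp C v (\<iota> i)"
    and F: "is_functor I C F"
  shows "u = v"
proof -
  have \<iota>: "\<iota> i \<in> hom C (OnOb F i) X" if "i \<in> Ob I" for i
    using assms(1) that by (simp add: is_colimit_def is_cocone_def)
  have "is_cocone I C F Y (\<lambda>i. Cmp C u (\<iota> i))"
    unfolding is_cocone_def
  proof (intro conjI ballI)
    show "Y \<in> Ob C" using assms(2) Cod_in by (auto simp: hom_def)
  next
    fix i assume "i \<in> Ob I"
    then show "Cmp C u (\<iota> i) \<in> hom C (OnOb F i) Y"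
      using Cmp_in assms(2) \<iota> by blast
  next
    fix k assume k: "k \<in> Arr I"
    then have Ob: "Dom I k \<in> Ob I" "Cod I k \<in> Ob I"
      using assms(4) by (auto intro: category.Dom_in category.Cod_in)
    have "OnArr F k \<in> hom C (OnOb F (Dom I k)) (OnOb F (Cod I k))"
      using F k by (simp add: is_functor_def)
    then have "Cmp C (Cmp C u (\<iota> (Cod I k))) (OnArr F k) =
        Cmp C u (Cmp C (\<iota> (Cod I k)) (OnArr F k))"
      using Cmp_assoc assms(2) \<iota>[OF Ob(2)] by metis
    then show "Cmp C (Cmp C u (\<iota> (Cod I k))) (OnArr F k) = Cmp C u (\<iota> (Dom I k))"
      using assms(1) k by (simp add: is_colimit_def is_cocone_def)
  qed
  then have "\<exists>!w. w \<in> hom C X Y \<and> (\<forall>i\<in>Ob I. Cmp C w (\<iota> i) = Cmp C u (\<iota> i))"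
    using assms(1) by (simp add: is_colimit_def)
  then obtain w where w: "w' = w"
    if "w' \<in> hom C X Y" "\<And>i. i \<in> Ob I \<Longrightarrow> Cmp C w' (\<iota> i) = Cmp C u (\<iota> i)" for w'
    by (elim ex1E) blast
  show ?thesis using w[OF assms(2)] w[OF assms(3)] eq by simp
qed

end

section \<open>Interleavings as families of morphisms\<close>

lemma poset_cat_simps [simp]:
  "Ob (poset_cat S) = S"
  "(a, b) \<in> Arr (poset_cat S) \<longleftrightarrow> a \<in> S \<and> b \<in> S \<and> a \<le> b"
  "Dom (poset_cat S) = fst" "Cod (poset_cat S) = snd"
  "Idn (poset_cat S) a = (a, a)"
  "Cmp (poset_cat S) g f = (fst f, snd g)"
  by (auto simp: poset_cat_def)

lemma ball_Arr_poset_cat: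
  "(\<forall>f\<in>Arr (poset_cat S). Q f) \<longleftrightarrow> (\<forall>a\<in>S. \<forall>b\<in>S. a \<le> b \<longrightarrow> Q (a, b))"
  by (auto simp: poset_cat_def)

lemma is_functor_poset_cat_iff:
  "is_functor (poset_cat S) C F \<longleftrightarrow>
     (\<forall>i\<in>S. OnOb F i \<in> Ob C) \<and>
     (\<forall>a\<in>S. \<forall>b\<in>S. a \<le> b \<longrightarrow> OnArr F (a, b) \<in> hom C (OnOb F a) (OnOb F b)) \<and>
     (\<forall>i\<in>S. OnArr F (i, i) = Idn C (OnOb F i)) \<and>
     (\<forall>a\<in>S. \<forall>b\<in>S. \<forall>c\<in>S. a \<le> b \<longrightarrow> b \<le> c \<longrightarrow>
        OnArr F (a, c) = Cmp C (OnArr F (b, c)) (OnArr F (a, b)))"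
  unfolding is_functor_def ball_Arr_poset_cat poset_cat_simps fst_conv snd_conv
  by (intro conj_cong refl) blast

lemma is_functor_poset_cat_mono:
  assumes "is_functor (poset_cat P) C F" "S \<subseteq> P"
  shows "is_functor (poset_cat S) C F"
proof -
  have "Arr (poset_cat S) \<subseteq> Arr (poset_cat P)"
    using assms(2) by (auto simp: poset_cat_def)
  then show ?thesis
    using assms unfolding is_functor_def poset_cat_simps(1,3-6)
    by (elim conjE, intro conjI ballI) (blast dest: subsetD)+
qed

text \<open>The universe type disappears here: existence of limits and colimits is assumed just for
  diagrams on subposets of \<open>P\<close>, which include all the up-sets and down-sets.\<close>

locale height_setting = category C
  for C :: "('o, 'm) cat" +
  fixes P :: "'p::order set" and \<rho> :: "'p \<Rightarrow> 'p \<Rightarrow> ennreal"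
  assumes limits: "S \<subseteq> P \<Longrightarrow> is_functor (poset_cat S) C F \<Longrightarrow> \<exists>X \<pi>. is_limit (poset_cat S) C F X \<pi>"
    and colimits: "S \<subseteq> P \<Longrightarrow> is_functor (poset_cat S) C F \<Longrightarrow> \<exists>X \<iota>. is_colimit (poset_cat S) C F X \<iota>"
    and height: "height_difference P \<rho>"
begin

abbreviation is_pfun :: "('p, 'o, 'm) pfun \<Rightarrow> bool" where
  "is_pfun M \<equiv> is_functor (poset_cat P) C M"

abbreviation comp (infixr "\<cdot>" 70) where "g \<cdot> f \<equiv> Cmp C g f"

text \<open>Membership in a down-set and membership in an up-set are one relation read from its two
  ends. This symmetric form is the index set of the families below.\<close>

definition rel :: "real \<Rightarrow> 'p \<Rightarrow> 'p \<Rightarrow> bool" where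
  "rel r x y \<longleftrightarrow> x \<in> P \<and> y \<in> P \<and> x \<le> y \<and> ennreal r \<le> \<rho> x y"

lemma relD: "rel r x y \<Longrightarrow> x \<in> P" "rel r x y \<Longrightarrow> y \<in> P" "rel r x y \<Longrightarrow> x \<le> y"
  by (auto simp: rel_def)

lemma down_set_eq: "a \<in> P \<Longrightarrow> down_set P \<rho> r a = {x. rel r x a}"
  and up_set_eq: "a \<in> P \<Longrightarrow> up_set P \<rho> r a = {y. rel r a y}"
  by (auto simp: down_set_def up_set_def rel_def)

lemma down_set_sub: "down_set P \<rho> r a \<subseteq> P" and up_set_sub: "up_set P \<rho> r a \<subseteq> P"
  by (auto simp: down_set_def up_set_def)

lemma height_add:
  assumes "a \<in> P" "b \<in> P" "c \<in> P" "a \<le> b" "b \<le> c"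
  shows "\<rho> a b + \<rho> b c \<le> \<rho> a c"
  using height assms unfolding height_difference_def by blast

text \<open>Superadditivity of \<rho>: moving an endpoint outwards can only increase the height
  difference.\<close>

lemma rel_up:
  assumes "rel r x y" "y' \<in> P" "y \<le> y'"
  shows "rel r x y'"
proof -
  have "ennreal r \<le> \<rho> x y" "x \<le> y" using assms by (simp_all add: rel_def)
  then have "ennreal r \<le> \<rho> x y + \<rho> y y'" by (simp add: add_increasing2)
  also have "\<dots> \<le> \<rho> x y'" using assms relD[OF assms(1)] by (intro height_add)
  finally show ?thesis
    using assms relD[OF assms(1)] \<open>x \<le> y\<close> order_trans[of x y y'] by (simp add: rel_def)
qed

lemma rel_down:
  assumes "rel r x y" "x' \<in> P" "x' \<le> x"
  shows "rel r x' y"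
proof -
  have "ennreal r \<le> \<rho> x y" "x \<le> y" using assms by (simp_all add: rel_def)
  then have "ennreal r \<le> \<rho> x' x + \<rho> x y" by (simp add: add_increasing)
  also have "\<dots> \<le> \<rho> x' y" using assms relD[OF assms(1)] by (intro height_add)
  finally show ?thesis
    using assms relD[OF assms(1)] \<open>x \<le> y\<close> order_trans[of x' x y] by (simp add: rel_def)
qed

lemma functor_Ob: "is_pfun M \<Longrightarrow> x \<in> P \<Longrightarrow> OnOb M x \<in> Ob C"
  by (simp add: is_functor_def)

lemma functor_hom:
  assumes "is_pfun M" "x \<in> P" "y \<in> P" "x \<le> y"
  shows "OnArr M (x, y) \<in> hom C (OnOb M x) (OnOb M y)"
  using assms unfolding is_functor_poset_cat_iff by blast

lemma functor_Cmp:
  assumes "is_pfun M" "x \<in> P" "y \<in> P" "z \<in> P" "x \<le> y" "y \<le> z"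
  shows "OnArr M (y, z) \<cdot> OnArr M (x, y) = OnArr M (x, z)"
proof -
  have "\<forall>a\<in>P. \<forall>b\<in>P. \<forall>c\<in>P. a \<le> b \<longrightarrow> b \<le> c \<longrightarrow>
      OnArr M (a, c) = OnArr M (b, c) \<cdot> OnArr M (a, b)"
    using assms(1) unfolding is_functor_poset_cat_iff by (elim conjE)
  from this[rule_format, OF assms(2-6)] show ?thesis by (rule sym)
qed

section \<open>The universal properties of the values of \<open>L_functor\<close> and
  \<open>R_functor\<close>\<close>

lemma is_colimit_L:
  assumes "is_pfun M"
  shows "is_colimit (poset_cat (down_set P \<rho> r a)) C M (L_obj P \<rho> C r M a) (L_alpha P \<rho> C r M a)"
  unfolding L_obj_def L_alpha_def
  by (intro is_colimit_colimit colimits down_set_sub is_functor_poset_cat_mono[OF assms])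

lemma is_limit_R:
  assumes "is_pfun M"
  shows "is_limit (poset_cat (up_set P \<rho> r a)) C M (R_obj P \<rho> C r M a) (R_beta P \<rho> C r M a)"
  unfolding R_obj_def R_beta_def
  by (intro is_limit_limit limits up_set_sub is_functor_poset_cat_mono[OF assms])

lemma is_cocone_L: "is_pfun M \<Longrightarrow>
    is_cocone (poset_cat (down_set P \<rho> r a)) C M (L_obj P \<rho> C r M a) (L_alpha P \<rho> C r M a)"
  using is_colimit_L unfolding is_colimit_def by (rule conjunct1)

lemma is_cone_R: "is_pfun M \<Longrightarrow>
    is_cone (poset_cat (up_set P \<rho> r a)) C M (R_obj P \<rho> C r M a) (R_beta P \<rho> C r M a)"
  using is_limit_R unfolding is_limit_def by (rule conjunct1)

lemma alpha_hom:
  assumes "is_pfun M" "rel r x a"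
  shows "L_alpha P \<rho> C r M a x \<in> hom C (OnOb M x) (L_obj P \<rho> C r M a)"
  using is_cocone_L[OF assms(1), of r a] assms(2) relD(2)[OF assms(2)]
  by (simp add: is_cocone_def down_set_eq)

lemma beta_hom:
  assumes "is_pfun M" "rel r a y"
  shows "R_beta P \<rho> C r M a y \<in> hom C (R_obj P \<rho> C r M a) (OnOb M y)"
  using is_cone_R[OF assms(1), of r a] assms(2) relD(1)[OF assms(2)]
  by (simp add: is_cone_def up_set_eq)

lemma beta_natural:
  assumes "is_pfun M" "rel r a y" "y' \<in> P" "y \<le> y'"
  shows "OnArr M (y, y') \<cdot> R_beta P \<rho> C r M a y = R_beta P \<rho> C r M a y'"
  using is_cone_R[OF assms(1), of r a] assms relD[OF assms(2)] rel_up[OF assms(2-4)]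
  unfolding is_cone_def ball_Arr_poset_cat by (simp add: up_set_eq)

text \<open>The universal property of the colimit, stated through \<open>rel\<close>. Compatibility
  asks for \<open>rel\<close> only at the larger point \<open>x'\<close>; the smaller point
  \<open>x\<close> inherits it by \<open>rel_down\<close>.\<close>

lemma L_map:
  assumes "is_pfun M" "a \<in> P" "Y \<in> Ob C"
    and "\<And>x. rel r x a \<Longrightarrow> \<kappa> x \<in> hom C (OnOb M x) Y"
    and "\<And>x x'. rel r x' a \<Longrightarrow> x \<in> P \<Longrightarrow> x \<le> x' \<Longrightarrow> \<kappa> x' \<cdot> OnArr M (x, x') = \<kappa> x"
  shows "from_colimit (poset_cat (down_set P \<rho> r a)) C M Y \<kappa> \<in> hom C (L_obj P \<rho> C r M a) Y"
    and "rel r x a \<Longrightarrow>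
      from_colimit (poset_cat (down_set P \<rho> r a)) C M Y \<kappa> \<cdot> L_alpha P \<rho> C r M a x = \<kappa> x"
proof -
  have cc: "is_cocone (poset_cat (down_set P \<rho> r a)) C M Y \<kappa>"
    using assms(2-5) relD unfolding is_cocone_def ball_Arr_poset_cat
    by (simp add: down_set_eq)
  note * = from_colimit[OF colimits[OF down_set_sub is_functor_poset_cat_mono[OF assms(1) down_set_sub]] cc]
  show "from_colimit (poset_cat (down_set P \<rho> r a)) C M Y \<kappa> \<in> hom C (L_obj P \<rho> C r M a) Y"
    unfolding L_obj_def by (rule *(1))
  show "from_colimit (poset_cat (down_set P \<rho> r a)) C M Y \<kappa> \<cdot> L_alpha P \<rho> C r M a x = \<kappa> x" if "rel r x a"
    unfolding L_alpha_def using that assms(2) by (intro *(2)) (simp add: down_set_eq)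
qed

lemma R_map:
  assumes "is_pfun M" "a \<in> P" "Y \<in> Ob C"
    and "\<And>y. rel r a y \<Longrightarrow> \<kappa> y \<in> hom C Y (OnOb M y)"
    and "\<And>y y'. rel r a y \<Longrightarrow> y' \<in> P \<Longrightarrow> y \<le> y' \<Longrightarrow> OnArr M (y, y') \<cdot> \<kappa> y = \<kappa> y'"
  shows "to_limit (poset_cat (up_set P \<rho> r a)) C M Y \<kappa> \<in> hom C Y (R_obj P \<rho> C r M a)"
    and "rel r a y \<Longrightarrow> R_beta P \<rho> C r M a y \<cdot> to_limit (poset_cat (up_set P \<rho> r a)) C M Y \<kappa> = \<kappa> y"
proof -
  have cc: "is_cone (poset_cat (up_set P \<rho> r a)) C M Y \<kappa>"
    using assms(2-5) relD unfolding is_cone_def ball_Arr_poset_cat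
    by (simp add: up_set_eq)
  note * = to_limit[OF limits[OF up_set_sub is_functor_poset_cat_mono[OF assms(1) up_set_sub]] cc]
  show "to_limit (poset_cat (up_set P \<rho> r a)) C M Y \<kappa> \<in> hom C Y (R_obj P \<rho> C r M a)"
    unfolding R_obj_def by (rule *(1))
  show "R_beta P \<rho> C r M a y \<cdot> to_limit (poset_cat (up_set P \<rho> r a)) C M Y \<kappa> = \<kappa> y" if "rel r a y"
    unfolding R_beta_def using that assms(2) by (intro *(2)) (simp add: up_set_eq)
qed

lemma R_obj_Ob: "is_pfun M \<Longrightarrow> R_obj P \<rho> C r M a \<in> Ob C"
  using is_cone_R by (simp add: is_cone_def)

lemma R_eqI:
  assumes "is_pfun M" "a \<in> P" "u \<in> hom C Y (R_obj P \<rho> C r M a)" "v \<in> hom C Y (R_obj P \<rho> C r M a)"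
    and "\<And>y. rel r a y \<Longrightarrow> R_beta P \<rho> C r M a y \<cdot> u = R_beta P \<rho> C r M a y \<cdot> v"
  shows "u = v"
  using assms(2,5)
  by (intro limit_arrow_eqI[OF is_limit_R[OF assms(1)] assms(3,4) category_poset_cat _
        is_functor_poset_cat_mono[OF assms(1) up_set_sub]]) (simp add: up_set_eq)

lemma L_eqI:
  assumes "is_pfun M" "a \<in> P" "u \<in> hom C (L_obj P \<rho> C r M a) Y" "v \<in> hom C (L_obj P \<rho> C r M a) Y"
    and "\<And>x. rel r x a \<Longrightarrow> u \<cdot> L_alpha P \<rho> C r M a x = v \<cdot> L_alpha P \<rho> C r M a x"
  shows "u = v"
  using assms(2,5)
  by (intro colimit_arrow_eqI[OF is_colimit_L[OF assms(1)] assms(3,4) category_poset_cat _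
        is_functor_poset_cat_mono[OF assms(1) down_set_sub]]) (simp add: down_set_eq)

text \<open>The structure morphism is induced by restricting the limit cone at \<open>a\<close> to
  the up-set of \<open>b\<close>, which is contained in the up-set of \<open>a\<close> by
  \<open>rel_down\<close>.\<close>

lemma R_functor_map:
  assumes "is_pfun M" "a \<in> P" "b \<in> P" "a \<le> b"
  shows "OnArr (R_functor P \<rho> C r M) (a, b) \<in> hom C (R_obj P \<rho> C r M a) (R_obj P \<rho> C r M b)"
    and "rel r b y \<Longrightarrow>
      R_beta P \<rho> C r M b y \<cdot> OnArr (R_functor P \<rho> C r M) (a, b) = R_beta P \<rho> C r M a y"
proof -
  have rel: "rel r a y" if "rel r b y" for y
    using rel_down that assms by blast
  note * = R_map[OF assms(1,3) R_obj_Ob[OF assms(1)], of r "R_beta P \<rho> C r M a"]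
  show "OnArr (R_functor P \<rho> C r M) (a, b) \<in> hom C (R_obj P \<rho> C r M a) (R_obj P \<rho> C r M b)"
    unfolding R_functor_def using assms(1) by (auto intro!: * beta_hom beta_natural rel)
  show "R_beta P \<rho> C r M b y \<cdot> OnArr (R_functor P \<rho> C r M) (a, b) = R_beta P \<rho> C r M a y"
    if "rel r b y"
    unfolding R_functor_def using assms(1) that by (auto intro!: * beta_hom beta_natural rel)
qed

section \<open>Families of morphisms in place of natural transformations\<close>

definition family ::
  "real \<Rightarrow> ('p, 'o, 'm) pfun \<Rightarrow> ('p, 'o, 'm) pfun \<Rightarrow> ('p \<Rightarrow> 'p \<Rightarrow> 'm) \<Rightarrow> bool" where
  "family r M N \<phi> \<longleftrightarrow>
     (\<forall>x y. rel r x y \<longrightarrow> \<phi> x y \<in> hom C (OnOb M x) (OnOb N y)) \<and>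
     (\<forall>x y y'. rel r x y \<longrightarrow> y' \<in> P \<longrightarrow> y \<le> y' \<longrightarrow> OnArr N (y, y') \<cdot> \<phi> x y = \<phi> x y') \<and>
     (\<forall>x x' y. rel r x' y \<longrightarrow> x \<in> P \<longrightarrow> x \<le> x' \<longrightarrow> \<phi> x' y \<cdot> OnArr M (x, x') = \<phi> x y)"

lemma familyD:
  assumes "family r M N \<phi>"
  shows "rel r x y \<Longrightarrow> \<phi> x y \<in> hom C (OnOb M x) (OnOb N y)"
    and "rel r x y \<Longrightarrow> y' \<in> P \<Longrightarrow> y \<le> y' \<Longrightarrow> OnArr N (y, y') \<cdot> \<phi> x y = \<phi> x y'"
    and "rel r x' y \<Longrightarrow> x \<in> P \<Longrightarrow> x \<le> x' \<Longrightarrow> \<phi> x' y \<cdot> OnArr M (x, x') = \<phi> x y"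
  using assms by (auto simp: family_def)

text \<open>The family \<phi> is the common data behind \<open>p\<close> and its adjoint: it is
  obtained from \<open>p\<close> by composing with the projections \<open>R_beta\<close>, and from
  \<open>sharp\<close> by composing with the coprojections \<open>L_alpha\<close>.\<close>

definition represents ::
  "real \<Rightarrow> ('p, 'o, 'm) pfun \<Rightarrow> ('p, 'o, 'm) pfun \<Rightarrow> ('p \<Rightarrow> 'm) \<Rightarrow> ('p \<Rightarrow> 'p \<Rightarrow> 'm) \<Rightarrow> bool" where
  "represents r M N p \<phi> \<longleftrightarrow> (\<forall>x y. rel r x y \<longrightarrow> R_beta P \<rho> C r N x y \<cdot> p x = \<phi> x y)"

text \<open>Naturality in the upper variable is the cone condition for \<open>R_beta\<close>;
  naturality in the lower variable is naturality of \<open>p\<close>.\<close>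

lemma family_of_nat_trans:
  assumes M: "is_pfun M" and N: "is_pfun N"
    and p: "nat_trans (poset_cat P) C M (R_functor P \<rho> C r N) p"
  shows "\<exists>\<phi>. family r M N \<phi> \<and> represents r M N p \<phi>"
proof (intro exI conjI)
  let ?\<phi> = "\<lambda>x y. R_beta P \<rho> C r N x y \<cdot> p x"
  show "represents r M N p ?\<phi>" by (simp add: represents_def)
  have p_hom: "p x \<in> hom C (OnOb M x) (R_obj P \<rho> C r N x)" if "x \<in> P" for x
    using p that by (simp add: nat_trans_def R_functor_def)
  have p_nat: "p x' \<cdot> OnArr M (x, x') = OnArr (R_functor P \<rho> C r N) (x, x') \<cdot> p x"
    if "x \<in> P" "x' \<in> P" "x \<le> x'" for x x'
    using p that unfolding nat_trans_def ball_Arr_poset_cat by simp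
  show "family r M N ?\<phi>"
    unfolding family_def
  proof (intro conjI allI impI)
    fix x y assume "rel r x y"
    then show "?\<phi> x y \<in> hom C (OnOb M x) (OnOb N y)"
      using Cmp_in p_hom beta_hom[OF N] relD by blast
  next
    fix x y y' assume xy: "rel r x y" "y' \<in> P" "y \<le> y'"
    have "OnArr N (y, y') \<cdot> ?\<phi> x y = (OnArr N (y, y') \<cdot> R_beta P \<rho> C r N x y) \<cdot> p x"
      using Cmp_assoc p_hom beta_hom[OF N xy(1)] functor_hom[OF N] xy relD[OF xy(1)] by blast
    then show "OnArr N (y, y') \<cdot> ?\<phi> x y = ?\<phi> x y'"
      using beta_natural[OF N xy] by simp
  next
    fix x x' y assume xy: "rel r x' y" "x \<in> P" "x \<le> x'"
    note P = relD[OF xy(1)]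
    have "?\<phi> x' y \<cdot> OnArr M (x, x') = R_beta P \<rho> C r N x' y \<cdot> p x' \<cdot> OnArr M (x, x')"
      using Cmp_assoc[OF functor_hom[OF M] p_hom beta_hom[OF N]] xy P by auto
    also have "\<dots> = R_beta P \<rho> C r N x' y \<cdot> OnArr (R_functor P \<rho> C r N) (x, x') \<cdot> p x"
      using p_nat xy P by simp
    also have "\<dots> = (R_beta P \<rho> C r N x' y \<cdot> OnArr (R_functor P \<rho> C r N) (x, x')) \<cdot> p x"
      using Cmp_assoc[OF p_hom R_functor_map(1)[OF N] beta_hom[OF N]] xy P by auto
    finally show "?\<phi> x' y \<cdot> OnArr M (x, x') = ?\<phi> x y"
      using R_functor_map(2)[OF N] xy P by simp
  qed
qed

text \<open>For fixed \<open>x\<close>, naturality in the upper variable makes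
  \<open>\<phi> x\<close> a cone, which induces \<open>p x\<close>. Naturality of \<open>p\<close>
  is an equation between arrows into a limit, so it is checked after each projection, where it
  becomes naturality of \<phi> in the lower variable.\<close>

lemma nat_trans_of_family:
  assumes M: "is_pfun M" and N: "is_pfun N" and \<phi>: "family r M N \<phi>"
  shows "\<exists>p. nat_trans (poset_cat P) C M (R_functor P \<rho> C r N) p \<and> represents r M N p \<phi>"
proof (intro exI conjI)
  let ?p = "\<lambda>x. to_limit (poset_cat (up_set P \<rho> r x)) C N (OnOb M x) (\<phi> x)"
  note p = R_map[OF N _ functor_Ob[OF M] familyD(1,2)[OF \<phi>]]
  show "represents r M N ?p \<phi>"
    unfolding represents_def using p(2) relD by blast
  show "nat_trans (poset_cat P) C M (R_functor P \<rho> C r N) ?p"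
    unfolding nat_trans_def
  proof (intro conjI ballI)
    fix i assume "i \<in> Ob (poset_cat P)"
    then show "?p i \<in> hom C (OnOb M i) (OnOb (R_functor P \<rho> C r N) i)"
      using p(1) by (simp add: R_functor_def)
  next
    fix k assume "k \<in> Arr (poset_cat P)"
    then obtain a b where k: "k = (a, b)" "a \<in> P" "b \<in> P" "a \<le> b" by (cases k) auto
    have "?p b \<cdot> OnArr M (a, b) = OnArr (R_functor P \<rho> C r N) (a, b) \<cdot> ?p a"
    proof (rule R_eqI[OF N \<open>b \<in> P\<close>])
      show "?p b \<cdot> OnArr M (a, b) \<in> hom C (OnOb M a) (R_obj P \<rho> C r N b)"
        using Cmp_in[OF functor_hom[OF M] p(1)] k by auto
      show "OnArr (R_functor P \<rho> C r N) (a, b) \<cdot> ?p a \<in> hom C (OnOb M a) (R_obj P \<rho> C r N b)"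
        using Cmp_in[OF p(1) R_functor_map(1)[OF N]] k by auto
      fix y assume y: "rel r b y"
      then have y': "rel r a y" using rel_down k by blast
      have "R_beta P \<rho> C r N b y \<cdot> ?p b \<cdot> OnArr M (a, b)
          = (R_beta P \<rho> C r N b y \<cdot> ?p b) \<cdot> OnArr M (a, b)"
        using Cmp_assoc[OF functor_hom[OF M] p(1) beta_hom[OF N]] k y by auto
      also have "\<dots> = \<phi> a y"
        using p(2) y k familyD(3)[OF \<phi>] by auto
      also have "\<dots> = R_beta P \<rho> C r N a y \<cdot> ?p a"
        using p(2) y' k by auto
      also have "\<dots> = (R_beta P \<rho> C r N b y \<cdot> OnArr (R_functor P \<rho> C r N) (a, b)) \<cdot> ?p a"
        using R_functor_map(2)[OF N k(2-4) y] by simp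
      also have "\<dots> = R_beta P \<rho> C r N b y \<cdot> OnArr (R_functor P \<rho> C r N) (a, b) \<cdot> ?p a"
        using Cmp_assoc[OF p(1) R_functor_map(1)[OF N] beta_hom[OF N]] k y by auto
      finally show "R_beta P \<rho> C r N b y \<cdot> ?p b \<cdot> OnArr M (a, b) =
        R_beta P \<rho> C r N b y \<cdot> OnArr (R_functor P \<rho> C r N) (a, b) \<cdot> ?p a" .
    qed
    then show "?p (Cod (poset_cat P) k) \<cdot> OnArr M k =
        OnArr (R_functor P \<rho> C r N) k \<cdot> ?p (Dom (poset_cat P) k)"
      using k by simp
  qed
qed

section \<open>The interleaving equations in terms of families\<close>

lemma L_eta:
  assumes M: "is_pfun M" and a: "a \<in> P"
  shows "L_eta P \<rho> C r M a \<in> hom C (L_obj P \<rho> C r M a) (OnOb M a)"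
    and "rel r x a \<Longrightarrow> L_eta P \<rho> C r M a \<cdot> L_alpha P \<rho> C r M a x = OnArr M (x, a)"
proof -
  note * = L_map[OF M a functor_Ob[OF M a], of r "\<lambda>x. OnArr M (x, a)"]
  show "L_eta P \<rho> C r M a \<in> hom C (L_obj P \<rho> C r M a) (OnOb M a)"
    unfolding L_eta_def by (intro *) (auto simp: functor_hom[OF M] functor_Cmp[OF M] relD a)
  show "L_eta P \<rho> C r M a \<cdot> L_alpha P \<rho> C r M a x = OnArr M (x, a)" if "rel r x a"
    unfolding L_eta_def using that
    by (intro *) (auto simp: functor_hom[OF M] functor_Cmp[OF M] relD a)
qed

lemma R_eta:
  assumes M: "is_pfun M" and a: "a \<in> P"
  shows "R_eta P \<rho> C r M a \<in> hom C (OnOb M a) (R_obj P \<rho> C r M a)"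
    and "rel r a y \<Longrightarrow> R_beta P \<rho> C r M a y \<cdot> R_eta P \<rho> C r M a = OnArr M (a, y)"
proof -
  note * = R_map[OF M a functor_Ob[OF M a], of r "\<lambda>y. OnArr M (a, y)"]
  show "R_eta P \<rho> C r M a \<in> hom C (OnOb M a) (R_obj P \<rho> C r M a)"
    unfolding R_eta_def by (intro *) (auto simp: functor_hom[OF M] functor_Cmp[OF M] relD a)
  show "R_beta P \<rho> C r M a y \<cdot> R_eta P \<rho> C r M a = OnArr M (a, y)" if "rel r a y"
    unfolding R_eta_def using that
    by (intro *) (auto simp: functor_hom[OF M] functor_Cmp[OF M] relD a)
qed

text \<open>Since \<open>p\<close> represents \<phi>, the cocone defining the adjoint is the one
  with components \<open>\<phi> x a\<close>; its compatibility is naturality of \<phi> in the lower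
  variable.\<close>

lemma sharp:
  assumes M: "is_pfun M" and N: "is_pfun N" and a: "a \<in> P"
    and \<phi>: "family r M N \<phi>" and p: "represents r M N p \<phi>"
  shows "sharp P \<rho> C r M N p a \<in> hom C (L_obj P \<rho> C r M a) (OnOb N a)"
    and "rel r x a \<Longrightarrow> sharp P \<rho> C r M N p a \<cdot> L_alpha P \<rho> C r M a x = \<phi> x a"
proof -
  let ?\<kappa> = "\<lambda>x. R_beta P \<rho> C r N x a \<cdot> p x"
  have \<kappa>: "?\<kappa> x = \<phi> x a" if "rel r x a" for x
    using p that by (simp add: represents_def)
  have 1: "?\<kappa> x \<in> hom C (OnOb M x) (OnOb N a)" if "rel r x a" for x
    using \<kappa> familyD(1)[OF \<phi>] that by simp
  have 2: "?\<kappa> x' \<cdot> OnArr M (x, x') = ?\<kappa> x" if "rel r x' a" "x \<in> P" "x \<le> x'" for x x'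
    using \<kappa> familyD(3)[OF \<phi> that] that rel_down[OF that] by simp
  show "sharp P \<rho> C r M N p a \<in> hom C (L_obj P \<rho> C r M a) (OnOb N a)"
    unfolding sharp_def by (rule L_map(1)[OF M a functor_Ob[OF N a]]) (fact 1 2)+
  show "sharp P \<rho> C r M N p a \<cdot> L_alpha P \<rho> C r M a x = \<phi> x a" if "rel r x a"
    unfolding sharp_def \<kappa>[OF that, symmetric]
    by (rule L_map(2)[OF M a functor_Ob[OF N a] _ _ that]) (fact 1 2)+
qed

lemma beta_comp_alpha:
  assumes M: "is_pfun M" and N: "is_pfun N" and a: "rel r x a" "rel r a y"
    and u: "u \<in> hom C (L_obj P \<rho> C r M a) Z" and v: "v \<in> hom C Z (R_obj P \<rho> C r N a)"
  shows "R_beta P \<rho> C r N a y \<cdot> (v \<cdot> u) \<cdot> L_alpha P \<rho> C r M a x =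
    (R_beta P \<rho> C r N a y \<cdot> v) \<cdot> (u \<cdot> L_alpha P \<rho> C r M a x)"
proof -
  note hom = alpha_hom[OF M a(1)] beta_hom[OF N a(2)]
  have "(v \<cdot> u) \<cdot> L_alpha P \<rho> C r M a x = v \<cdot> u \<cdot> L_alpha P \<rho> C r M a x"
    using Cmp_assoc[OF hom(1) u v] by simp
  then show ?thesis
    using Cmp_assoc[OF Cmp_in[OF hom(1) u] v hom(2)] by simp
qed

text \<open>An arrow from a colimit to a limit is determined by its matrix entries, that is, by its
  composites with one coprojection and one projection.\<close>

lemma beta_alpha_eqI:
  assumes M: "is_pfun M" and N: "is_pfun N" and a: "a \<in> P"
    and u: "u \<in> hom C (L_obj P \<rho> C r M a) (R_obj P \<rho> C r N a)"
    and v: "v \<in> hom C (L_obj P \<rho> C r M a) (R_obj P \<rho> C r N a)"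
    and eq: "\<And>x y. rel r x a \<Longrightarrow> rel r a y \<Longrightarrow>
      R_beta P \<rho> C r N a y \<cdot> u \<cdot> L_alpha P \<rho> C r M a x = R_beta P \<rho> C r N a y \<cdot> v \<cdot> L_alpha P \<rho> C r M a x"
  shows "u = v"
proof (rule L_eqI[OF M a u v])
  fix x assume x: "rel r x a"
  show "u \<cdot> L_alpha P \<rho> C r M a x = v \<cdot> L_alpha P \<rho> C r M a x"
    by (rule R_eqI[OF N a Cmp_in[OF alpha_hom[OF M x] u] Cmp_in[OF alpha_hom[OF M x] v]])
       (rule eq[OF x])
qed

text \<open>Compare matrix entries. Those of \<open>e_map\<close> are \<open>M(a \<le> y)\<close>
  after \<open>M(x \<le> a)\<close>, hence \<open>M(x \<le> y)\<close>; those of the other side are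
  \<open>\<psi> a y\<close> after \<open>\<phi> x a\<close>.\<close>

lemma e_map_eq_iff:
  assumes M: "is_pfun M" and N: "is_pfun N" and a: "a \<in> P"
    and \<phi>: "family r M N \<phi>" "represents r M N p \<phi>"
    and q: "nat_trans (poset_cat P) C N (R_functor P \<rho> C r M) q"
    and \<psi>: "represents r N M q \<psi>"
  shows "e_map P \<rho> C r M a = q a \<cdot> sharp P \<rho> C r M N p a \<longleftrightarrow>
    (\<forall>x y. rel r x a \<longrightarrow> rel r a y \<longrightarrow> \<psi> a y \<cdot> \<phi> x a = OnArr M (x, y))"
proof -
  note sh = sharp[OF M N a \<phi>]
  have qa: "q a \<in> hom C (OnOb N a) (R_obj P \<rho> C r M a)"
    using q a by (simp add: nat_trans_def R_functor_def)
  have e: "R_beta P \<rho> C r M a y \<cdot> e_map P \<rho> C r M a \<cdot> L_alpha P \<rho> C r M a x = OnArr M (x, y)"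
    if "rel r x a" "rel r a y" for x y
    unfolding e_map_def
    using beta_comp_alpha[OF M M that L_eta(1)[OF M a] R_eta(1)[OF M a]] that
      functor_Cmp[OF M] relD L_eta(2)[OF M a] R_eta(2)[OF M a]
    by simp
  have s: "R_beta P \<rho> C r M a y \<cdot> (q a \<cdot> sharp P \<rho> C r M N p a) \<cdot> L_alpha P \<rho> C r M a x = \<psi> a y \<cdot> \<phi> x a"
    if "rel r x a" "rel r a y" for x y
    using beta_comp_alpha[OF M M that sh(1) qa] that sh(2) \<psi> by (simp add: represents_def)
  have "e_map P \<rho> C r M a \<in> hom C (L_obj P \<rho> C r M a) (R_obj P \<rho> C r M a)"
    unfolding e_map_def by (rule Cmp_in[OF L_eta(1)[OF M a] R_eta(1)[OF M a]])
  from beta_alpha_eqI[OF M M a this Cmp_in[OF sh(1) qa]] e s show ?thesis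
    by (metis (no_types, lifting))
qed

text \<open>This removes limits and colimits from the problem: the composition arguments below work
  with families alone.\<close>

lemma height_interleaved_iff:
  assumes M: "is_pfun M" and N: "is_pfun N"
  shows "height_interleaved P \<rho> C r M N \<longleftrightarrow>
    (\<exists>\<phi> \<psi>. family r M N \<phi> \<and> family r N M \<psi> \<and>
      (\<forall>x a y. rel r x a \<longrightarrow> rel r a y \<longrightarrow> \<psi> a y \<cdot> \<phi> x a = OnArr M (x, y)) \<and>
      (\<forall>x a y. rel r x a \<longrightarrow> rel r a y \<longrightarrow> \<phi> a y \<cdot> \<psi> x a = OnArr N (x, y)))"
  (is "?L \<longleftrightarrow> ?R")
proof
  assume ?L
  then obtain p q where pq: "nat_trans (poset_cat P) C M (R_functor P \<rho> C r N) p"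
      "nat_trans (poset_cat P) C N (R_functor P \<rho> C r M) q"
    and e: "\<forall>a\<in>P. e_map P \<rho> C r M a = q a \<cdot> sharp P \<rho> C r M N p a"
      "\<forall>a\<in>P. e_map P \<rho> C r N a = p a \<cdot> sharp P \<rho> C r N M q a"
    unfolding height_interleaved_def by blast
  obtain \<phi> \<psi> where \<phi>: "family r M N \<phi>" "represents r M N p \<phi>"
    and \<psi>: "family r N M \<psi>" "represents r N M q \<psi>"
    using family_of_nat_trans[OF M N pq(1)] family_of_nat_trans[OF N M pq(2)] by blast
  show ?R
    using e e_map_eq_iff[OF M N _ \<phi> pq(2) \<psi>(2)] e_map_eq_iff[OF N M _ \<psi> pq(1) \<phi>(2)] \<phi> \<psi> relD
    by (intro exI[of _ \<phi>] exI[of _ \<psi>]) blast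
next
  assume ?R
  then obtain \<phi> \<psi> where \<phi>: "family r M N \<phi>" and \<psi>: "family r N M \<psi>"
    and e: "\<forall>x a y. rel r x a \<longrightarrow> rel r a y \<longrightarrow> \<psi> a y \<cdot> \<phi> x a = OnArr M (x, y)"
      "\<forall>x a y. rel r x a \<longrightarrow> rel r a y \<longrightarrow> \<phi> a y \<cdot> \<psi> x a = OnArr N (x, y)"
    by blast
  obtain p q where p: "nat_trans (poset_cat P) C M (R_functor P \<rho> C r N) p" "represents r M N p \<phi>"
    and q: "nat_trans (poset_cat P) C N (R_functor P \<rho> C r M) q" "represents r N M q \<psi>"
    using nat_trans_of_family[OF M N \<phi>] nat_trans_of_family[OF N M \<psi>] by blast
  show ?L
    unfolding height_interleaved_def
    using e e_map_eq_iff[OF M N _ \<phi> p(2) q] e_map_eq_iff[OF N M _ \<psi> q(2) p] p q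
    by (intro exI[of _ p] exI[of _ q]) blast
qed

section \<open>Composition of interleavings\<close>

text \<open>Cut at height \<open>r + c / 2\<close>, so that each half has a surplus of
  \<open>c / 2\<close> to absorb the error allowed by \<open>IV\<close>: the lower part keeps height
  at least \<open>r\<close> and the upper part at least \<open>s\<close>.\<close>

lemma IV_split:
  assumes IV: "IV P \<rho> c" and c: "0 \<le> c" and r: "0 \<le> r" and s: "0 \<le> s" and xy: "rel (r + s + c) x y"
  shows "\<exists>z. rel r x z \<and> rel s z y"
proof -
  let ?t = "r + c / 2"
  have "ennreal ?t \<le> ennreal (r + s + c)"
    using r s c by (intro ennreal_leI) simp
  then have t: "ennreal ?t \<le> \<rho> x y" using xy by (auto simp: rel_def intro: order_trans)
  then obtain z where z: "z \<in> P" "x \<le> z" "z \<le> y"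
    and d1: "dist_inf (\<rho> x z) (ennreal ?t) \<le> ennreal (c / 2)"
    and d2: "dist_inf (\<rho> z y) (\<rho> x y - ennreal ?t) \<le> ennreal (c / 2)"
    using IV xy r c unfolding IV_def rel_def by (metis add_nonneg_nonneg divide_nonneg_pos zero_less_numeral)
  \<comment> \<open>For infinite \<open>u\<close> nothing is to be shown. For finite
    \<open>u\<close> the bound rules out infinite \<open>v\<close>, since their
    \<open>dist_inf\<close> would be infinite, and an estimate between reals remains.\<close>
  have key: "ennreal (w - c / 2) \<le> u"
    if "dist_inf u v \<le> ennreal (c / 2)" "ennreal w \<le> v" for u v w
  proof (cases u)
    case (real a)
    from that(1) real have "v < \<infinity>"
      by (auto simp: dist_inf_def top_unique split: if_splits)
    then obtain b where b: "v = ennreal b" "0 \<le> b" by (cases v) auto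
    have "\<bar>a - b\<bar> \<le> c / 2"
      using that(1) real b c by (simp add: dist_inf_def)
    moreover have "w \<le> b"
      using that(2) b by simp
    ultimately have "w - c / 2 \<le> a" by linarith
    then show ?thesis using real by (auto intro!: ennreal_leI)
  qed simp
  have "ennreal r \<le> \<rho> x z" using key[OF d1, of ?t] by simp
  moreover have "ennreal s \<le> \<rho> z y"
  proof -
    have "ennreal (s + c / 2) = ennreal (r + s + c) - ennreal ?t"
      using r c by (subst ennreal_minus) auto
    also have "\<dots> \<le> \<rho> x y - ennreal ?t"
      using xy by (intro ennreal_minus_mono) (auto simp: rel_def)
    finally show ?thesis using key[OF d2] by fastforce
  qed
  ultimately show ?thesis using z xy by (auto simp: rel_def)
qed

text \<open>The second conclusion allows any intermediate point to be used. Naturality follows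
  because a point \<open>z\<close> between \<open>x\<close> and \<open>y\<close> still serves after
  an endpoint is moved outwards, and the inverse equations will choose their own intermediate
  points.\<close>

lemma family_composite:
  assumes cip: "CIP P \<rho>" and IV: "IV P \<rho> c" and c: "0 \<le> c" and r: "0 \<le> r" and s: "0 \<le> s"
    and M: "is_pfun M" and X: "is_pfun X" and N: "is_pfun N"
    and \<phi>: "family r M X \<phi>" and \<phi>': "family s X N \<phi>'"
  shows "\<exists>\<theta>. family (r + s + c) M N \<theta> \<and>
    (\<forall>x z y. rel r x z \<longrightarrow> rel s z y \<longrightarrow> \<theta> x y = \<phi>' z y \<cdot> \<phi> x z)"
proof -
  define G where "G x z y \<longleftrightarrow> rel r x z \<and> rel s z y" for x z y
  \<comment> \<open>Both composites equal the one that passes through the structure map of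
    \<open>X\<close> from \<open>z\<close> to \<open>z'\<close>.\<close>
  have move: "\<phi>' z y \<cdot> \<phi> x z = \<phi>' z' y \<cdot> \<phi> x z'" if "G x z y" "G x z' y" "z \<le> z'" for x y z z'
  proof -
    have z: "rel r x z" "rel s z y" "rel r x z'" "rel s z' y" "z \<in> P" "z' \<in> P"
      using that by (auto simp: G_def relD)
    have "\<phi>' z y \<cdot> \<phi> x z = (\<phi>' z' y \<cdot> OnArr X (z, z')) \<cdot> \<phi> x z"
      using familyD(3)[OF \<phi>' z(4,5) that(3)] by simp
    also have "\<dots> = \<phi>' z' y \<cdot> OnArr X (z, z') \<cdot> \<phi> x z"
      using Cmp_assoc[OF familyD(1)[OF \<phi>] functor_hom[OF X] familyD(1)[OF \<phi>']] z that(3) by auto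
    also have "\<dots> = \<phi>' z' y \<cdot> \<phi> x z'"
      using familyD(2)[OF \<phi> z(1,6) that(3)] by simp
    finally show ?thesis .
  qed
  have indep: "\<phi>' z y \<cdot> \<phi> x z = \<phi>' z' y \<cdot> \<phi> x z'" if G: "G x z y" "G x z' y" for x y z z'
  proof -
    have P: "x \<in> P" "y \<in> P" using G by (auto simp: G_def relD)
    \<comment> \<open>The admissible intermediate points form exactly one of the intersections in
      \<open>CIP\<close>, so \<open>move\<close> can be iterated along a zigzag inside it.\<close>
    define S where "S = down_set P \<rho> s y \<inter> up_set P \<rho> r x"
    have S: "w \<in> S \<longleftrightarrow> G x w y" for w
      using P by (auto simp: S_def down_set_eq up_set_eq G_def)
    have "S = {} \<or> zigzag_connected S"
      using cip[unfolded CIP_def, rule_format, OF P(2,1) s r] by (simp only: S_def)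
    then have "(z, z') \<in> {(u, v). u \<in> S \<and> v \<in> S \<and> (u \<le> v \<or> v \<le> u)}\<^sup>*"
      using G S unfolding zigzag_connected_def by blast
    then show ?thesis
    proof (induction rule: rtrancl_induct)
      case (step v w)
      then have G: "G x v y" "G x w y" and le: "v \<le> w \<or> w \<le> v" using S by auto
      from le have "\<phi>' v y \<cdot> \<phi> x v = \<phi>' w y \<cdot> \<phi> x w"
        using move[OF G] move[OF G(2,1), symmetric] by (rule disjE)
      then show ?case using step.IH by simp
    qed simp
  qed
  \<comment> \<open>Where no intermediate point exists the value is arbitrary; the pairs relevant to
    \<open>family\<close> have one by \<open>IV_split\<close>.\<close>
  define \<theta> where "\<theta> x y = (let z = (SOME z. G x z y) in \<phi>' z y \<cdot> \<phi> x z)" for x y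
  have \<theta>: "\<theta> x y = \<phi>' z y \<cdot> \<phi> x z" if "rel r x z" "rel s z y" for x y z
  proof -
    have G: "G x z y" using that by (simp add: G_def)
    show ?thesis
      unfolding \<theta>_def Let_def by (rule indep[OF someI[of "\<lambda>z. G x z y", OF G] G])
  qed
  have "family (r + s + c) M N \<theta>"
    unfolding family_def
  proof (intro conjI allI impI)
    fix x y assume "rel (r + s + c) x y"
    then obtain z where z: "rel r x z" "rel s z y" using IV_split[OF IV c r s] by blast
    show "\<theta> x y \<in> hom C (OnOb M x) (OnOb N y)"
      unfolding \<theta>[OF z] by (rule Cmp_in[OF familyD(1)[OF \<phi> z(1)] familyD(1)[OF \<phi>' z(2)]])
  next
    fix x y y' assume xy: "rel (r + s + c) x y" "y' \<in> P" "y \<le> y'"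
    then obtain z where z: "rel r x z" "rel s z y" using IV_split[OF IV c r s] by blast
    have "OnArr N (y, y') \<cdot> \<phi>' z y \<cdot> \<phi> x z = (OnArr N (y, y') \<cdot> \<phi>' z y) \<cdot> \<phi> x z"
      by (rule Cmp_assoc[OF familyD(1)[OF \<phi> z(1)] familyD(1)[OF \<phi>' z(2)]
            functor_hom[OF N relD(2)[OF xy(1)] xy(2,3)]])
    also have "\<dots> = \<phi>' z y' \<cdot> \<phi> x z"
      using familyD(2)[OF \<phi>' z(2) xy(2,3)] by simp
    finally show "OnArr N (y, y') \<cdot> \<theta> x y = \<theta> x y'"
      unfolding \<theta>[OF z] \<theta>[OF z(1) rel_up[OF z(2) xy(2,3)]] .
  next
    fix x x' y assume xy: "rel (r + s + c) x' y" "x \<in> P" "x \<le> x'"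
    then obtain z where z: "rel r x' z" "rel s z y" using IV_split[OF IV c r s] by blast
    have "(\<phi>' z y \<cdot> \<phi> x' z) \<cdot> OnArr M (x, x') = \<phi>' z y \<cdot> \<phi> x' z \<cdot> OnArr M (x, x')"
      by (rule Cmp_assoc[OF functor_hom[OF M xy(2) relD(1)[OF xy(1)] xy(3)]
            familyD(1)[OF \<phi> z(1)] familyD(1)[OF \<phi>' z(2)], symmetric])
    also have "\<dots> = \<phi>' z y \<cdot> \<phi> x z"
      using familyD(3)[OF \<phi> z(1) xy(2,3)] by simp
    finally show "\<theta> x' y \<cdot> OnArr M (x, x') = \<theta> x y"
      unfolding \<theta>[OF z] \<theta>[OF rel_down[OF z(1) xy(2,3)] z(2)] .
  qed
  with \<theta> show ?thesis by blast
qed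

text \<open>The inner round trip from \<open>X\<close> through \<open>N\<close> back to
  \<open>X\<close> collapses to a structure map of \<open>X\<close>, which naturality of \<psi>
  absorbs. What remains is a round trip of the first interleaving at \<open>z\<close>.\<close>

lemma composite_inverse:
  assumes IV: "IV P \<rho> c" and c: "0 \<le> c" and r: "0 \<le> r" and s: "0 \<le> s"
    and X: "is_pfun X"
    and \<phi>: "family r M X \<phi>" and \<psi>: "family r X M \<psi>"
    and \<phi>': "family s X N \<phi>'" and \<psi>': "family s N X \<psi>'"
    and M_eq: "\<And>x a y. rel r x a \<Longrightarrow> rel r a y \<Longrightarrow> \<psi> a y \<cdot> \<phi> x a = OnArr M (x, y)"
    and X_eq: "\<And>x a y. rel s x a \<Longrightarrow> rel s a y \<Longrightarrow> \<psi>' a y \<cdot> \<phi>' x a = OnArr X (x, y)"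
    and \<theta>: "\<And>x z y. rel r x z \<Longrightarrow> rel s z y \<Longrightarrow> \<theta> x y = \<phi>' z y \<cdot> \<phi> x z"
    and \<omega>: "\<And>x z y. rel s x z \<Longrightarrow> rel r z y \<Longrightarrow> \<omega> x y = \<psi> z y \<cdot> \<psi>' x z"
    and xa: "rel (r + s + c) x a" and ay: "rel (r + s + c) a y"
  shows "\<omega> a y \<cdot> \<theta> x a = OnArr M (x, y)"
proof -
  obtain z where z: "rel r x z" "rel s z a" using IV_split[OF IV c r s xa] by blast
  \<comment> \<open>The way back traverses the two interleavings in reverse order, so the split is
    made with \<open>s\<close> first.\<close>
  obtain w where w: "rel s a w" "rel r w y"
    using IV_split[OF IV c s r, of a y] ay by (auto simp: add.commute)
  have zw: "z \<in> P" "w \<in> P" "z \<le> w"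
    using relD[OF z(2)] relD[OF w(1)] by auto
  note hom = familyD(1)[OF \<phi> z(1)] familyD(1)[OF \<phi>' z(2)] familyD(1)[OF \<psi>' w(1)] familyD(1)[OF \<psi> w(2)]
  have "\<omega> a y \<cdot> \<theta> x a = (\<psi> w y \<cdot> \<psi>' a w) \<cdot> (\<phi>' z a \<cdot> \<phi> x z)"
    using \<theta>[OF z] \<omega>[OF w] by simp
  also have "\<dots> = \<psi> w y \<cdot> (\<psi>' a w \<cdot> \<phi>' z a) \<cdot> \<phi> x z"
    using Cmp_assoc[OF Cmp_in[OF hom(1,2)] hom(3,4)] Cmp_assoc[OF hom(1-3)] by simp
  also have "\<dots> = (\<psi> w y \<cdot> OnArr X (z, w)) \<cdot> \<phi> x z"
    using Cmp_assoc[OF hom(1) functor_hom[OF X zw] hom(4)] X_eq[OF z(2) w(1)] by simp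
  also have "\<dots> = \<psi> z y \<cdot> \<phi> x z"
    using familyD(3)[OF \<psi> w(2) zw(1,3)] by simp
  also have "\<dots> = OnArr M (x, y)"
    by (rule M_eq[OF z(1) rel_down[OF w(2) zw(1,3)]])
  finally show ?thesis .
qed

text \<open>Both directions come from \<open>family_composite\<close> and both round trips from
  \<open>composite_inverse\<close>; the second instance exchanges \<open>M\<close>, \<open>r\<close>
  with \<open>N\<close>, \<open>s\<close> and therefore arises at height
  \<open>s + r + c\<close>.\<close>

lemma height_interleaved_trans:
  assumes cip: "CIP P \<rho>" and IV: "IV P \<rho> c" and c: "0 \<le> c" and r: "0 \<le> r" and s: "0 \<le> s"
    and M: "is_pfun M" and X: "is_pfun X" and N: "is_pfun N"
    and MX: "height_interleaved P \<rho> C r M X" and XN: "height_interleaved P \<rho> C s X N"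
  shows "height_interleaved P \<rho> C (r + s + c) M N"
proof -
  obtain \<phi> \<psi> where 1: "family r M X \<phi>" "family r X M \<psi>"
    and e1: "\<And>x a y. rel r x a \<Longrightarrow> rel r a y \<Longrightarrow> \<psi> a y \<cdot> \<phi> x a = OnArr M (x, y)"
      "\<And>x a y. rel r x a \<Longrightarrow> rel r a y \<Longrightarrow> \<phi> a y \<cdot> \<psi> x a = OnArr X (x, y)"
    using MX unfolding height_interleaved_iff[OF M X] by blast
  obtain \<phi>' \<psi>' where 2: "family s X N \<phi>'" "family s N X \<psi>'"
    and e2: "\<And>x a y. rel s x a \<Longrightarrow> rel s a y \<Longrightarrow> \<psi>' a y \<cdot> \<phi>' x a = OnArr X (x, y)"
      "\<And>x a y. rel s x a \<Longrightarrow> rel s a y \<Longrightarrow> \<phi>' a y \<cdot> \<psi>' x a = OnArr N (x, y)"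
    using XN unfolding height_interleaved_iff[OF X N] by blast
  obtain \<theta> where \<theta>: "family (r + s + c) M N \<theta>"
    "\<And>x z y. rel r x z \<Longrightarrow> rel s z y \<Longrightarrow> \<theta> x y = \<phi>' z y \<cdot> \<phi> x z"
    using family_composite[OF cip IV c r s M X N 1(1) 2(1)] by blast
  obtain \<omega> where \<omega>: "family (s + r + c) N M \<omega>"
    "\<And>x z y. rel s x z \<Longrightarrow> rel r z y \<Longrightarrow> \<omega> x y = \<psi> z y \<cdot> \<psi>' x z"
    using family_composite[OF cip IV c s r N X M 2(2) 1(2)] by blast
  have sr: "s + r + c = r + s + c" by simp
  show ?thesis
    unfolding height_interleaved_iff[OF M N]
    using \<theta>(1) \<omega>(1)[unfolded sr]
      composite_inverse[OF IV c r s X 1 2 e1(1) e2(1) \<theta>(2) \<omega>(2)]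
      composite_inverse[OF IV c s r X 2(2,1) 1(2,1) e2(2) e1(2) \<omega>(2) \<theta>(2), unfolded sr]
    by (intro exI[of _ \<theta>] exI[of _ \<omega>]) blast
qed

text \<open>The bound holds for every admissible triple of values, and the three vary independently,
  so the infimum is taken in one summand at a time.\<close>

theorem height_dist_relaxed_triangle:
  assumes cip: "CIP P \<rho>" and M: "is_pfun M" and X: "is_pfun X" and N: "is_pfun N"
  shows "height_dist P \<rho> C M N \<le> height_dist P \<rho> C M X + height_dist P \<rho> C X N + iv_const P \<rho>"
proof -
  define A where "A M N = {ennreal r | r. 0 \<le> r \<and> height_interleaved P \<rho> C r M N}" for M N
  define B where "B = {ennreal c | c. 0 \<le> c \<and> IV P \<rho> c}"
  have *: "height_dist P \<rho> C M N \<le> u + v + w" if "u \<in> A M X" "v \<in> A X N" "w \<in> B" for u v w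
  proof -
    obtain r s c where rsc: "u = ennreal r" "0 \<le> r" "height_interleaved P \<rho> C r M X"
      "v = ennreal s" "0 \<le> s" "height_interleaved P \<rho> C s X N"
      "w = ennreal c" "0 \<le> c" "IV P \<rho> c"
      using \<open>u \<in> A M X\<close> \<open>v \<in> A X N\<close> \<open>w \<in> B\<close> unfolding A_def B_def by blast
    then have "height_interleaved P \<rho> C (r + s + c) M N"
      using height_interleaved_trans[OF cip _ _ _ _ M X N] by blast
    then have "height_dist P \<rho> C M N \<le> ennreal (r + s + c)"
      unfolding height_dist_def using rsc
      by (intro Inf_lower CollectI exI[of _ "r + s + c"] conjI refl) simp_all
    also have "\<dots> = u + v + w" using rsc by simp
    finally show ?thesis .
  qed
  \<comment> \<open>A finite \<open>y\<close> is moved across by truncated subtraction, which makes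
    \<open>x - y\<close> a lower bound of \<open>S\<close>. An empty \<open>S\<close> is covered
    too, its infimum being infinite.\<close>
  have add_Inf: "x \<le> y + Inf S" if "\<And>z. z \<in> S \<Longrightarrow> x \<le> y + z" for x y :: ennreal and S
  proof (cases "y = \<infinity>")
    case False
    then have "x - y \<le> Inf S"
      using that by (intro Inf_greatest) (simp add: ennreal_minus_le_iff)
    then show ?thesis by (rule ennreal_minus_le_iff[THEN iffD1, THEN conjunct1])
  qed simp
  have 1: "height_dist P \<rho> C M N \<le> v + w + Inf (A M X)" if "v \<in> A X N" "w \<in> B" for v w
    by (rule add_Inf) (use *[OF _ that] in \<open>simp only: ac_simps\<close>)
  have 2: "height_dist P \<rho> C M N \<le> Inf (A M X) + w + Inf (A X N)" if "w \<in> B" for w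
    by (rule add_Inf) (use 1[OF _ that] in \<open>simp only: ac_simps\<close>)
  have "height_dist P \<rho> C M N \<le> Inf (A M X) + Inf (A X N) + Inf B"
    by (rule add_Inf) (use 2 in \<open>simp only: ac_simps\<close>)
  then show ?thesis by (simp add: height_dist_def iv_const_def A_def B_def)
qed

end

text \<open>Two incomparable points between \<open>q\<close> and \<open>a\<close> differ from both
  endpoints and would form a diamond with them. Hence any two points of the intersection are joined
  by a zigzag of one step.\<close>

lemma diamond_free_CIP:
  assumes "diamond_free P"
  shows "CIP P \<rho>"
  unfolding CIP_def
\<comment> \<open>The second alternative is proved in all cases: \<open>zigzag_connected\<close>
  holds vacuously for the empty set.\<close>
proof (intro ballI allI impI disjI2)
  fix a q s r assume P: "a \<in> P" "q \<in> P"
  have "x \<le> y \<or> y \<le> x" if "x \<in> P" "y \<in> P" "q \<le> x" "q \<le> y" "x \<le> a" "y \<le> a" for x y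
    using assms P that unfolding diamond_free_def by (metis order.order_iff_strict)
  then show "zigzag_connected (down_set P \<rho> s a \<inter> up_set P \<rho> r q)"
    unfolding zigzag_connected_def down_set_def up_set_def by blast
qed

theorem proposition5p9:
  fixes C :: "('o, 'm) cat" and P :: "'p::order set"
  assumes "category C"
    and "complete_category TYPE('u) C"
    and "cocomplete_category TYPE('u) C"
    and "small_set TYPE('u) (Arr (poset_cat P))"
    and "diamond_free P"
  shows "\<forall>\<rho>. height_difference P \<rho> \<longrightarrow>
           CIP P \<rho> \<and>
           (\<forall>M X N. is_functor (poset_cat P) C M \<longrightarrow> is_functor (poset_cat P) C X \<longrightarrow>
              is_functor (poset_cat P) C N \<longrightarrow>
              height_dist P \<rho> C M N \<le> height_dist P \<rho> C M X + height_dist P \<rho> C X N + iv_const P \<rho>)"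
proof (intro allI impI)
  fix \<rho> assume \<rho>: "height_difference P \<rho>"
  \<comment> \<open>Smallness of \<open>P\<close> passes to its subposets, which provides the limits
    and colimits that \<open>height_setting\<close> requires.\<close>
  have small: "small_set TYPE('u) (Arr (poset_cat S))" if "S \<subseteq> P" for S
  proof -
    have "Arr (poset_cat S) \<subseteq> Arr (poset_cat P)" using that by (auto simp: poset_cat_def)
    then show ?thesis using assms(4) unfolding small_set_def by (metis inj_on_subset)
  qed
  have "height_setting C P \<rho>"
    using assms(1) \<rho> complete_category_has_limit[OF assms(2) category_poset_cat small]
      cocomplete_category_has_colimit[OF assms(3) category_poset_cat small]
    by (intro height_setting.intro height_setting_axioms.intro)
  then show "CIP P \<rho> \<and>
           (\<forall>M X N. is_functor (poset_cat P) C M \<longrightarrow> is_functor (poset_cat P) C X \<longrightarrow>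
              is_functor (poset_cat P) C N \<longrightarrow>
              height_dist P \<rho> C M N \<le> height_dist P \<rho> C M X + height_dist P \<rho> C X N + iv_const P \<rho>)"
    using diamond_free_CIP[OF assms(5)] height_setting.height_dist_relaxed_triangle by blast
qed

end
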